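(* There are absolute constants $c_1,c_2>0$ such that for all integers $n\ge1$, $j\ge1$ and all integers $0\le d_1<\dots<d_k<q$, $$c_1\,A_{2n,1}\big([\mathcal{E}_q^{\{d_1,\dots,d_k\}}]_j\big)\le K_{2n}\big([\mathscr{C}_q^{\{d_1,\dots,d_k\}}]_j\big)\le c_2\,A_{2n,1}\big([\mathcal{E}_q^{\{d_1,\dots,d_k\}}]_j\big).$$ In particular (for $k\ge2$), $\kappa_{2n}(C_q^{\{d_1,\dots,d_k\}})=\alpha_{2n}(\mathcal{E}_q^{\{d_1,\dots,d_k\}})$.
   Context: Let $0\le d_1<\dots<d_k<q$ be integers. $[\mathcal{E}_q^{\{d_1,\dots,d_k\}}]_j$ is the set of integers $\sum_{s=0}^{j-1}a_sq^s$ with all $a_s\in\{d_1,\dots,d_k\}$, and the ellipsephic set $\mathcal{E}_q^{\{d_1,\dots,d_k\}}$ is the union of these over $j\geq 1$. The arithmetic Cantor set $C_q^{\{d_1,\dots,d_k\}}\subset[0,1]$ is the attractor of the iterated function system $x\mapsto q^{-1}(x+d_i)$, $i=1,\dots,k$; its $j$-th level is $[C_q^{\{d_1,\dots,d_k\}}]_j=q^{-j}([\mathcal{E}_q^{\{d_1,\dots,d_k\}}]_j+[0,1])$, and $[\mathscr{C}_q^{\{d_1,\dots,d_k\}}]_j$ is the collection of the $k^j$ intervals $[q^{-j}\ell,q^{-j}(\ell+1)]$, $\ell\in[\mathcal{E}_q^{\{d_1,\dots,d_k\}}]_j$, making up this level. For $S\subset\mathbb{Z}^m$, $A_{p,m}(S)$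 is the best constant such that $$\Big\|\sum_{\ell\in S}a(\ell)e(\ell\cdot x)\Big\|_{L^p([0,1]^m)}\le A_{p,m}(S)\Big(\sum_{\ell\in S}|a(\ell)|^2\Big)^{1/2}$$ for all $a:S\to\mathbb{R}_{\ge0}$, where $e(t)=e^{2\pi it}$. For a subset $\Omega\subset[0,1]$ partitioned (up to endpoints) into intervals $I$ of equal length, $K_p(\Omega)$ is the best constant such that $$\Big\|\sum_If_I\Big\|_{L^p(\mathbb{R})}\le K_p(\Omega)\Big(\sum_I\|f_I\|_{L^p(\mathbb{R})}^2\Big)^{1/2}$$ for all Schwartz functions $f:\mathbb{R}\to\mathbb{C}$, where $\widehat{f_I}=\widehat f\,1_I$. $K_p([\mathscr{C}_q^{\{d_1,\dots,d_k\}}]_j)$ refers to $\Omega=[C_q^{\{d_1,\dots,d_k\}}]_j$ with the partition $[\mathscr{C}_q^{\{d_1,\dots,d_k\}}]_j$. The decoupling exponents are $$\alpha_{2n}(\mathcal{E}_q^{\{d_1,\dots,d_k\}})=\limsup_{j\to\infty}\frac{\log A_{2n,1}([\mathcal{E}_q^{\{d_1,\dots,d_k\}}]_j)}{\log k^j},\qquad \kappa_{2n}(C_q^{\{d_1,\dots,d_k\}})=\limsup_{j\to\infty}\frac{\log K_{2n}([\mathscr{C}_q^{\{d_1,\dots,d_k\}}]_j)}{\log k^j}.$$ *)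

theory Defs
  imports "HOL-Analysis.Analysis"
begin

text \<open>The convention at \<open>\<infinity>\<close> is the right one only for exponents \<open>r > 0\<close>.\<close>

definition ennreal_powr :: "ennreal \<Rightarrow> real \<Rightarrow> ennreal" where
  "ennreal_powr x r = (if x = \<infinity> then \<infinity> else ennreal (enn2real x powr r))"

definition ennreal_ln :: "ennreal \<Rightarrow> ereal" where
  "ennreal_ln x = (if x = 0 then -\<infinity> else if x = \<infinity> then \<infinity> else ereal (ln (enn2real x)))"

text \<open>The norm is built on the nonnegative integral, so that it is \<open>\<infinity>\<close> (and not \<open>0\<close>) on
  measurable functions outside \<open>L\<^sup>p\<close>.\<close>

definition Lp_norm :: "real \<Rightarrow> 'a measure \<Rightarrow> ('a \<Rightarrow> complex) \<Rightarrow> ennreal" where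
  "Lp_norm p M f = ennreal_powr (\<integral>\<^sup>+ x. ennreal (norm (f x) powr p) \<partial>M) (1 / p)"

definition ellipsephic_level :: "int set \<Rightarrow> int \<Rightarrow> nat \<Rightarrow> int set" where
  "ellipsephic_level D q j = {(\<Sum>s<j. a s * q ^ s) | a. \<forall>s<j. a s \<in> D}"

definition cantor_intervals :: "int set \<Rightarrow> int \<Rightarrow> nat \<Rightarrow> real set set" where
  "cantor_intervals D q j =
     {{real_of_int l / real_of_int q ^ j .. (real_of_int l + 1) / real_of_int q ^ j} | l.
        l \<in> ellipsephic_level D q j}"

definition e :: "real \<Rightarrow> complex" where
  "e t = exp (2 * of_real pi * \<i> * of_real t)"

text \<open>\<open>F m\<close> is the \<open>m\<close>-th derivative of \<open>f\<close>.\<close>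

definition schwartz :: "(real \<Rightarrow> complex) \<Rightarrow> bool" where
  "schwartz f \<longleftrightarrow> (\<exists>F :: nat \<Rightarrow> real \<Rightarrow> complex. F 0 = f \<and>
     (\<forall>m x. (F m has_vector_derivative F (Suc m) x) (at x)) \<and>
     (\<forall>m r. bounded (range (\<lambda>x. x ^ r *\<^sub>R F m x))))"

definition fourier :: "(real \<Rightarrow> complex) \<Rightarrow> real \<Rightarrow> complex" where
  "fourier f \<xi> = (LINT x|lborel. f x * e (- (x * \<xi>)))"

text \<open>The function whose Fourier transform is \<open>\<xi> \<mapsto> fourier f \<xi> * indicator I \<xi>\<close>. It need not
  be integrable, so it is given by Fourier inversion of this bounded, compactly supported function
  (for \<open>f\<close> Schwartz and \<open>I\<close> a bounded interval).\<close>

definition freq_restrict :: "real set \<Rightarrow> (real \<Rightarrow> complex) \<Rightarrow> real \<Rightarrow> complex" where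
  "freq_restrict I f x = (LINT \<xi>:I|lborel. fourier f \<xi> * e (x * \<xi>))"

text \<open>Best constants are infima in \<open>ennreal\<close>, hence \<open>\<infinity>\<close> if no finite constant is admissible.
  \<open>A_const p S\<close> is $A_{p,1}(S)$, for finite sets \<open>S\<close> of integers.\<close>

definition A_const :: "real \<Rightarrow> int set \<Rightarrow> ennreal" where
  "A_const p S = Inf {C. \<forall>a :: int \<Rightarrow> real. (\<forall>l\<in>S. 0 \<le> a l) \<longrightarrow>
     Lp_norm p (restrict_space lborel {0..1})
         (\<lambda>x. \<Sum>l\<in>S. of_real (a l) * e (real_of_int l * x))
       \<le> C * ennreal (sqrt (\<Sum>l\<in>S. (\<bar>a l\<bar>)\<^sup>2))}"

text \<open>Here \<open>P\<close> is the finite collection of intervals; \<open>\<Omega>\<close> is its union and enters the inequality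
  only through \<open>P\<close>.\<close>

definition K_const :: "real \<Rightarrow> real set set \<Rightarrow> ennreal" where
  "K_const p P = Inf {C. \<forall>f. schwartz f \<longrightarrow>
     Lp_norm p lborel (\<lambda>x. \<Sum>I\<in>P. freq_restrict I f x)
       \<le> C * ennreal_powr (\<Sum>I\<in>P. (Lp_norm p lborel (freq_restrict I f))\<^sup>2) (1 / 2)}"

definition alpha_exponent :: "real \<Rightarrow> int set \<Rightarrow> int \<Rightarrow> ereal" where
  "alpha_exponent p D q =
     limsup (\<lambda>j. ennreal_ln (A_const p (ellipsephic_level D q j)) / ereal (ln (real (card D) ^ j)))"

definition kappa_exponent :: "real \<Rightarrow> int set \<Rightarrow> int \<Rightarrow> ereal" where
  "kappa_exponent p D q =
     limsup (\<lambda>j. ennreal_ln (K_const p (cantor_intervals D q j)) / ereal (ln (real (card D) ^ j)))"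

end

theory Submission
  imports Defs "HOL-Probability.Probability"
begin

text \<open>Let \<open>S\<close> be a finite set of integers, \<open>p = 2 n\<close>, and let \<open>f\<^sub>l\<close> have its frequencies in
  \<open>[l / N, (l + 1) / N]\<close> for \<open>l \<in> S\<close>.

  Upper bound for \<open>K\<close>: in $\|\sum f_l\|_{2n}^{2n} = \|(\sum f_l)^n\|_2^2$ expand the \<open>n\<close>-th power over
  tuples. By orthogonality and Hoelder's inequality only pairs of tuples with equal sums contribute,
  up to a factor \<open>n + 1\<close> for the overlap of the frequency supports, and the resulting sum is exactly
  $\int_0^1 |\sum \|f_l\|_{2n} e(l x)|^{2n} dx$. The constant is harmless because $(n+1)^{1/(2n)} \le 2$.

  Lower bound: test with $f(x) = \sum a_l e((l + 1/2) x / N) \gamma(x)$ for a very wide Gaussian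
  \<open>\<gamma>\<close>. Its Fourier transform concentrates at the midpoints of the intervals, so each \<open>f\<^sub>l\<close> is
  close to the corresponding summand, and periodicity turns the norm on the line into the norm on
  \<open>[0, 1]\<close>. Working with Gaussians, whose Fourier tails tend to \<open>0\<close>, avoids constructing Schwartz
  functions with compactly supported Fourier transform.\<close>

section \<open>Gaussians and Fourier integrals\<close>

text \<open>Even exponents make the two constants comparable: for coefficients \<ge> 0 every term of
  the expanded moment on the circle is nonnegative, so estimating the integrals over the line
  termwise in absolute value still lands on a moment that the discrete inequality controls. This is
  why nonnegative coefficients are the right ones in the discrete constant. The obstacle on the line
  is that a sharply cut piece of a Schwartz function decays in general only like 1/|x|. Pieces are
  therefore handled as inverse transforms of integrable densities; a Gaussian factor is inserted
  where an integral over the line is to be interchanged with one over frequency, and it is removed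
  by a limit. Both directions carry a small \<eta> > 0: in the upper bound because Hoelder's
  inequality is proved by dividing by the norms of the pieces, which may vanish; in the lower bound
  because Gaussian spectra leak into the other intervals. The bounds are continuous in \<eta>, so
  \<eta> tends to 0 and leaves no trace in the constants.\<close>

definition gauss :: "real \<Rightarrow> real \<Rightarrow> real" where
  "gauss s x = exp (- (pi * (s * x)\<^sup>2))"

definition inv_fourier :: "(real \<Rightarrow> complex) \<Rightarrow> real \<Rightarrow> complex" where
  "inv_fourier h x = (LINT \<xi>|lborel. h \<xi> * e (x * \<xi>))"

text \<open>Turns an identity between a real integral and a complex expression into an inequality,
  so the complex side is never shown to be real before it is estimated.\<close>

lemma of_real_eq_imp_le_norm: "complex_of_real x = z \<Longrightarrow> x \<le> norm z"
  by auto

lemma norm_e [simp]: "norm (e t) = 1"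
proof -
  have "e t = cis (2 * pi * t)"
    by (simp add: e_def cis_conv_exp mult_ac)
  then show ?thesis by simp
qed

lemma e_add: "e (s + t) = e s * e t"
  by (simp add: e_def exp_add [symmetric] algebra_simps)

lemma e_0 [simp]: "e 0 = 1"
  by (simp add: e_def)

lemma cnj_e: "cnj (e t) = e (- t)"
  by (simp add: e_def exp_cnj)

lemma continuous_on_e [continuous_intros]:
  "continuous_on A f \<Longrightarrow> continuous_on A (\<lambda>x. e (f x))"
  unfolding e_def by (intro continuous_intros)

lemma e_measurable [measurable]: "e \<in> borel_measurable borel"
  by (intro borel_measurable_continuous_onI continuous_intros)

lemma gauss_pos: "gauss s x > 0"
  by (simp add: gauss_def)

lemma gauss_le_1: "gauss s x \<le> 1"
  by (simp add: gauss_def)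

lemma gauss_measurable [measurable]: "gauss s \<in> borel_measurable borel"
  unfolding gauss_def by measurable

lemma gauss_antimono: "\<bar>x\<bar> \<le> \<bar>y\<bar> \<Longrightarrow> gauss s y \<le> gauss s x"
  unfolding gauss_def by (simp add: abs_le_square_iff power_mult_distrib mult_left_mono)

lemma gauss_integrable:
  assumes "s \<noteq> 0" shows "integrable lborel (gauss s)"
proof -
  have "integrable lborel std_normal_density"
    using integrable_std_normal_moment[of 0] by simp
  from lborel_integrable_real_affine[OF this, of "sqrt (2*pi) * s" 0]
  have "integrable lborel (\<lambda>x. std_normal_density (sqrt (2*pi) * s * x))"
    using assms by simp
  then have "integrable lborel (\<lambda>x. sqrt (2*pi) * std_normal_density (sqrt (2*pi) * s * x))"
    by simp
  also have "(\<lambda>x. sqrt (2*pi) * std_normal_density (sqrt (2*pi) * s * x)) = gauss s"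
    by (auto simp: normal_density_def gauss_def power_mult_distrib fun_eq_iff)
  finally show ?thesis .
qed

lemma gauss_mult_e_integrable:
  assumes "s \<noteq> 0" shows "integrable lborel (\<lambda>x. of_real (gauss s x) * e (x * y))"
  by (rule Bochner_Integration.integrable_bound[OF gauss_integrable[OF assms]])
     (auto simp: norm_mult)

text \<open>Rescaling by \<open>sqrt (2*pi) * s\<close> turns the standard normal density into a
  multiple of \<open>gauss s\<close>; what remains is the characteristic function of the normal law.
  The normalisation with \<open>pi\<close> makes the family self-dual, with \<open>s\<close>
  replaced by \<open>1 / s\<close>.\<close>

lemma gauss_fourier:
  assumes "s > 0"
  shows "(LINT x|lborel. of_real (gauss s x) * e (x * y)) = of_real (gauss (1 / s) y / s)"
proof -
  let ?c = "sqrt (2*pi) * s"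
  have *: "std_normal_density (?c * x) = gauss s x / sqrt (2*pi)" for x
    by (auto simp: normal_density_def gauss_def power_mult_distrib)
  have "complex_of_real (exp (- ((2*pi*y/?c)^2) / 2)) = char std_normal_distribution (2*pi*y/?c)"
    by (simp add: char_std_normal_distribution)
  also have "\<dots> = (LINT x|lborel. std_normal_density x *\<^sub>R iexp (2*pi*y/?c * x))"
    unfolding char_def by (subst integral_density) auto
  also have "\<dots> = ?c *\<^sub>R (LINT x|lborel. std_normal_density (?c * x) *\<^sub>R iexp (2*pi*y/?c * (?c * x)))"
    using assms by (subst lborel_integral_real_affine[where c="?c" and t=0]) auto
  also have "(\<lambda>x. std_normal_density (?c * x) *\<^sub>R iexp (2*pi*y/?c * (?c * x)))
      = (\<lambda>x. (1 / sqrt (2*pi)) *\<^sub>R (of_real (gauss s x) * e (x * y)))"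
    unfolding * using assms by (auto simp: e_def fun_eq_iff scaleR_conv_of_real field_simps)
  finally have "(LINT x|lborel. of_real (gauss s x) * e (x * y)) =
     of_real (exp (- ((2*pi*y/?c)^2) / 2)) / of_real s"
    using assms by (simp add: scaleR_conv_of_real)
  also have "(- ((2*pi*y/?c)^2) / 2) = -(pi * (1/s*y)^2)"
    using assms by (simp add: power_divide power_mult_distrib field_simps power2_eq_square)
  finally show ?thesis by (simp add: gauss_def)
qed

lemma gauss_integral:
  assumes "s > 0" shows "(LINT x|lborel. gauss s x) = 1 / s"
proof -
  have "complex_of_real (LINT x|lborel. gauss s x) = of_real (1 / s)"
    using gauss_fourier[OF assms, of 0] by (simp add: gauss_def)
  then show ?thesis by (simp only: of_real_eq_iff)
qed

section \<open>Inverse Fourier integrals of integrable densities\<close>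

lemma integrable_mult_e:
  assumes "integrable lborel h" shows "integrable lborel (\<lambda>\<xi>. h \<xi> * e (x * \<xi>))"
proof (rule Bochner_Integration.integrable_bound[OF assms])
  have [measurable]: "h \<in> borel_measurable borel" using assms by auto
  show "(\<lambda>\<xi>. h \<xi> * e (x * \<xi>)) \<in> borel_measurable lborel" by measurable
qed (auto simp: norm_mult)

lemma inv_fourier_measurable [measurable]:
  assumes "h \<in> borel_measurable borel" shows "inv_fourier h \<in> borel_measurable borel"
proof -
  have [measurable]: "h \<in> borel_measurable borel" by fact
  show ?thesis unfolding inv_fourier_def by measurable
qed

lemma norm_inv_fourier_le:
  "norm (inv_fourier h x) \<le> (LINT \<xi>|lborel. norm (h \<xi>))"
  unfolding inv_fourier_def
  by (rule order_trans[OF integral_norm_bound]) (simp add: norm_mult)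

text \<open>The multiplication formula: Fubini with the majorant |\<phi>(x)| |h(\<xi>)|. Through it,
  size and support of the density \<open>h\<close> reach integrals over the line.\<close>

lemma integral_mult_inv_fourier:
  assumes h: "integrable lborel h" and p: "integrable lborel \<phi>"
  shows "(LINT x|lborel. \<phi> x * inv_fourier h x) =
         (LINT \<xi>|lborel. h \<xi> * (LINT x|lborel. \<phi> x * e (x * \<xi>)))"
proof -
  have [measurable]: "h \<in> borel_measurable borel" "\<phi> \<in> borel_measurable borel"
    using h p by auto
  have i: "integrable (lborel \<Otimes>\<^sub>M lborel) (\<lambda>(x, \<xi>). \<phi> x * (h \<xi> * e (x * \<xi>)))"
  proof (rule lborel_pair.Fubini_integrable)
    show "integrable lborel (\<lambda>x. LINT y|lborel. norm (case (x, y) of (x, \<xi>) \<Rightarrow> \<phi> x * (h \<xi> * e (x * \<xi>))))"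
      using p by (simp add: norm_mult)
    show "AE x in lborel. integrable lborel (\<lambda>y. case (x, y) of (x, \<xi>) \<Rightarrow> \<phi> x * (h \<xi> * e (x * \<xi>)))"
      using integrable_mult_e[OF h] by simp
  qed measurable
  have "(LINT x|lborel. \<phi> x * inv_fourier h x) = (LINT x|lborel. LINT \<xi>|lborel. \<phi> x * (h \<xi> * e (x * \<xi>)))"
    by (simp add: inv_fourier_def)
  also have "\<dots> = (LINT \<xi>|lborel. LINT x|lborel. \<phi> x * (h \<xi> * e (x * \<xi>)))"
    using lborel_pair.Fubini_integral[OF i] by simp
  also have "\<dots> = (LINT \<xi>|lborel. LINT x|lborel. h \<xi> * (\<phi> x * e (x * \<xi>)))"
    by (simp add: mult_ac)
  finally show ?thesis by simp
qed

text \<open>Fatou's lemma along s = 1, 1/2, 1/3, ...: \<open>gauss s\<close> tends to 1 pointwise,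
  so a bound uniform in \<open>s\<close> survives. The result can thus prove finiteness instead of
  presupposing it.\<close>

lemma gauss_nn_integral_limit:
  assumes [measurable]: "F \<in> borel_measurable borel"
    and le: "\<And>s. s > 0 \<Longrightarrow> (\<integral>\<^sup>+x. F x * ennreal (gauss s x) \<partial>lborel) \<le> C"
  shows "(\<integral>\<^sup>+x. F x \<partial>lborel) \<le> C"
proof -
  let ?g = "\<lambda>(m::nat) x. F x * ennreal (gauss (1 / real (Suc m)) x)"
  have lim: "(\<lambda>m. ?g m x) \<longlonglongrightarrow> F x" for x
  proof -
    have "(\<lambda>m. 1 / real (Suc m)) \<longlonglongrightarrow> 0"
      using LIMSEQ_inverse_real_of_nat by (simp add: inverse_eq_divide)
    then have "(\<lambda>m. gauss (1 / real (Suc m)) x) \<longlonglongrightarrow> exp (- (pi * (0 * x)\<^sup>2))"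
      unfolding gauss_def by (intro tendsto_intros)
    then have "(\<lambda>m. ennreal (gauss (1 / real (Suc m)) x)) \<longlonglongrightarrow> ennreal 1"
      by (intro tendsto_ennrealI) simp
    then have "(\<lambda>m. F x * ennreal (gauss (1 / real (Suc m)) x)) \<longlonglongrightarrow> F x * ennreal 1"
      by (intro ennreal_tendsto_cmult tendsto_mult_ennreal tendsto_const) auto
    then show ?thesis by simp
  qed
  have "(\<integral>\<^sup>+x. F x \<partial>lborel) = (\<integral>\<^sup>+x. liminf (\<lambda>m. ?g m x) \<partial>lborel)"
    using lim_imp_Liminf[OF _ lim] by (intro nn_integral_cong) simp
  also have "\<dots> \<le> liminf (\<lambda>m. \<integral>\<^sup>+x. ?g m x \<partial>lborel)"
    by (intro nn_integral_liminf) simp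
  also have "\<dots> \<le> C"
    by (intro Liminf_le always_eventually allI le) auto
  finally show ?thesis .
qed

text \<open>A substitute for Plancherel's theorem. Inserting \<open>gauss s\<close> makes Fubini applicable, and its
  Fourier transform is an approximate identity of mass \<open>1\<close>.\<close>

lemma inv_fourier_L2:
  assumes G: "integrable lborel G" and M: "\<And>\<xi>. norm (G \<xi>) \<le> M"
    and L: "(LINT \<xi>|lborel. norm (G \<xi>)) \<le> L"
  shows "(\<integral>\<^sup>+x. ennreal ((norm (inv_fourier G x))\<^sup>2) \<partial>lborel) \<le> ennreal (L * M)"
proof (rule gauss_nn_integral_limit)
  have [measurable]: "G \<in> borel_measurable borel" using G by auto
  show "(\<lambda>x. ennreal ((norm (inv_fourier G x))\<^sup>2)) \<in> borel_measurable borel" by measurable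
  fix s :: real assume s: "s > 0"
  let ?E = "inv_fourier G"
  have M0: "M \<ge> 0" using M[of 0] norm_ge_zero order_trans by blast
  let ?N = "(LINT \<xi>|lborel. norm (G \<xi>))"
  have bnd: "norm (?E x) \<le> ?N" for x by (rule norm_inv_fourier_le)
  have [measurable]: "(\<lambda>x. cnj (?E x)) \<in> borel_measurable borel"
    by (rule borel_measurable_continuous_on[of cnj]) (intro continuous_intros, measurable)
  have i1: "integrable lborel (\<lambda>x. cnj (?E x) * of_real (gauss s x))"
    by (rule Bochner_Integration.integrable_bound[of _ "\<lambda>x. ?N * gauss s x"])
       (use s bnd gauss_pos[of s] in \<open>auto simp: norm_mult abs_mult less_imp_le intro!: gauss_integrable mult_mono order_trans[OF _ abs_ge_self]\<close>)
  have inner: "norm (LINT x|lborel. cnj (?E x) * of_real (gauss s x) * e (x * \<xi>)) \<le> M" for \<xi>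
  proof -
    have "(LINT x|lborel. cnj (?E x) * of_real (gauss s x) * e (x * \<xi>)) =
       cnj (LINT x|lborel. (of_real (gauss s x) * e (x * (-\<xi>))) * ?E x)"
      unfolding Bochner_Integration.integral_cnj[symmetric]
      by (rule Bochner_Integration.integral_cong) (auto simp: cnj_e mult_ac)
    also have "(LINT x|lborel. (of_real (gauss s x) * e (x * (-\<xi>))) * ?E x) =
        (LINT \<eta>|lborel. G \<eta> * (LINT x|lborel. of_real (gauss s x) * e (x * (-\<xi>)) * e (x * \<eta>)))"
      using gauss_mult_e_integrable[of s "-\<xi>"] s by (intro integral_mult_inv_fourier G) auto
    also have "\<dots> = (LINT \<eta>|lborel. G \<eta> * (LINT x|lborel. of_real (gauss s x) * e (x * (\<eta> - \<xi>))))"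
      by (simp only: mult.assoc e_add[symmetric] distrib_left[symmetric] add.commute[of "-\<xi>"] diff_conv_add_uminus)
    also have "\<dots> = (LINT \<eta>|lborel. G \<eta> * of_real (gauss (1/s) (\<eta> - \<xi>) / s))"
      by (subst gauss_fourier[OF s]) (rule refl)
    finally have "norm (LINT x|lborel. cnj (?E x) * of_real (gauss s x) * e (x * \<xi>)) =
       norm (LINT \<eta>|lborel. G \<eta> * of_real (gauss (1/s) (\<eta> - \<xi>) / s))" by (simp only: complex_mod_cnj)
    also have "\<dots> \<le> (LINT \<eta>|lborel. M * (gauss (1/s) (-\<xi> + 1 * \<eta>) / s))"
    proof (rule order_trans[OF integral_norm_bound integral_mono'])
      show "integrable lborel (\<lambda>\<eta>. M * (gauss (1/s) (-\<xi> + 1 * \<eta>) / s))"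
        using lborel_integrable_real_affine[OF gauss_integrable[of "1/s"], of 1 "-\<xi>"] s by simp
      show "norm (G \<eta> * of_real (gauss (1/s) (\<eta> - \<xi>) / s)) \<le> M * (gauss (1/s) (-\<xi> + 1 * \<eta>) / s)" for \<eta>
        using mult_right_mono[OF M[of \<eta>], of "gauss (1/s) (\<eta> - \<xi>) / s"] s gauss_pos[of "1/s" "\<eta> - \<xi>"]
        by (simp add: norm_mult norm_divide less_imp_le)
    qed (use M0 s gauss_pos[THEN less_imp_le] in simp)
    also have "\<dots> = M * (LINT \<eta>|lborel. gauss (1/s) (-\<xi> + 1 * \<eta>)) / s"
      by simp
    also have "(LINT \<eta>|lborel. gauss (1/s) (-\<xi> + 1 * \<eta>)) = s"
      using lborel_integral_real_affine[of 1 "gauss (1/s)" "-\<xi>"] gauss_integral[of "1/s"] s by simp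
    finally show ?thesis using s by simp
  qed
  have i2: "integrable lborel (\<lambda>x. (norm (?E x))\<^sup>2 * gauss s x)"
    by (rule Bochner_Integration.integrable_bound[of _ "\<lambda>x. ?N\<^sup>2 * gauss s x"])
       (use s bnd gauss_pos[of s] in \<open>auto simp: norm_mult abs_mult less_imp_le intro!: gauss_integrable mult_mono power_mono order_trans[OF _ abs_ge_self]\<close>)
  \<comment> \<open>Only one factor of the squared modulus is opened as a Fourier integral; its
    conjugate stays in the test function, whose transform is bounded by \<open>M\<close> through
    \<open>inner\<close>. There remains \<open>M\<close> times the L^1 norm of
    \<open>G\<close>.\<close>
  have "complex_of_real (LINT x|lborel. (norm (?E x))\<^sup>2 * gauss s x) = (LINT x|lborel. of_real ((norm (?E x))\<^sup>2 * gauss s x))"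
    by (rule integral_complex_of_real[symmetric])
  also have "\<dots> = (LINT x|lborel. cnj (?E x) * of_real (gauss s x) * ?E x)"
    by (rule Bochner_Integration.integral_cong) (simp_all only: of_real_mult complex_norm_square mult_ac)
  also have "\<dots> = (LINT \<xi>|lborel. G \<xi> * (LINT x|lborel. cnj (?E x) * of_real (gauss s x) * e (x * \<xi>)))"
    by (rule integral_mult_inv_fourier[OF G i1])
  finally have "(LINT x|lborel. (norm (?E x))\<^sup>2 * gauss s x) \<le> norm \<dots>"
    by (rule of_real_eq_imp_le_norm)
  also have "\<dots> \<le> (LINT \<xi>|lborel. M * norm (G \<xi>))"
  proof (rule order_trans[OF integral_norm_bound integral_mono'])
    show "integrable lborel (\<lambda>\<xi>. M * norm (G \<xi>))" using G by simp
    show "norm (G x * (LINT xa|lborel. cnj (?E xa) * of_real (gauss s xa) * e (xa * x))) \<le> M * norm (G x)" for x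
      using mult_left_mono[OF inner[of x], of "norm (G x)"]
      by (simp only: norm_mult mult.commute[of M] norm_ge_zero simp_thms)
  qed (auto simp: M0)
  also have "\<dots> \<le> L * M"
    using mult_left_mono[OF L M0] by (simp add: mult.commute)
  finally have *: "(LINT x|lborel. (norm (?E x))\<^sup>2 * gauss s x) \<le> L * M" .
  have "(\<integral>\<^sup>+ x. ennreal ((norm (?E x))\<^sup>2) * ennreal (gauss s x) \<partial>lborel) =
      (\<integral>\<^sup>+ x. ennreal ((norm (?E x))\<^sup>2 * gauss s x) \<partial>lborel)"
    by (simp add: ennreal_mult gauss_pos less_imp_le)
  also have "\<dots> = ennreal (LINT x|lborel. (norm (?E x))\<^sup>2 * gauss s x)"
    by (rule nn_integral_eq_integral[OF i2]) (auto simp: gauss_pos less_imp_le)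
  also have "\<dots> \<le> ennreal (L * M)" using * by (rule ennreal_leI)
  finally show "(\<integral>\<^sup>+ x. ennreal ((norm (?E x))\<^sup>2) * ennreal (gauss s x) \<partial>lborel) \<le> ennreal (L * M)" .
qed

text \<open>All but two factors are bounded by the sup bound \<open>L\<close>, the last two by the
  L^2 estimate. For fixed \<open>L\<close> the result is linear in \<open>M\<close>: a density of
  bounded mass and tiny height has a tiny p-th moment, which is how frequency errors are
  estimated.\<close>

lemma inv_fourier_Lp:
  assumes G: "integrable lborel G" and M: "\<And>\<xi>. norm (G \<xi>) \<le> M"
    and L: "(LINT \<xi>|lborel. norm (G \<xi>)) \<le> L" and p: "p \<ge> 2"
  shows "(\<integral>\<^sup>+x. ennreal (norm (inv_fourier G x) ^ p) \<partial>lborel) \<le> ennreal (L ^ (p - 1) * M)"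
proof -
  have [measurable]: "G \<in> borel_measurable borel" using G by auto
  have L0: "0 \<le> L" by (rule order_trans[OF _ L]) simp
  have M0: "M \<ge> 0" using M[of 0] norm_ge_zero order_trans by blast
  have "(\<integral>\<^sup>+x. ennreal (norm (inv_fourier G x) ^ p) \<partial>lborel)
      \<le> (\<integral>\<^sup>+x. ennreal (L ^ (p - 2)) * ennreal ((norm (inv_fourier G x))\<^sup>2) \<partial>lborel)"
  proof (intro nn_integral_mono)
    fix x
    have "norm (inv_fourier G x) ^ p = norm (inv_fourier G x) ^ (p - 2) * (norm (inv_fourier G x))\<^sup>2"
      using p by (metis power_add le_add_diff_inverse2)
    also have "\<dots> \<le> L ^ (p - 2) * (norm (inv_fourier G x))\<^sup>2"
      by (intro mult_right_mono power_mono order_trans[OF norm_inv_fourier_le L]) auto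
    finally show "ennreal (norm (inv_fourier G x) ^ p) \<le> ennreal (L ^ (p - 2)) * ennreal ((norm (inv_fourier G x))\<^sup>2)"
      by (simp add: ennreal_mult[symmetric] L0)
  qed
  also have "\<dots> = ennreal (L ^ (p - 2)) * (\<integral>\<^sup>+x. ennreal ((norm (inv_fourier G x))\<^sup>2) \<partial>lborel)"
    by (rule nn_integral_cmult) simp
  also have "\<dots> \<le> ennreal (L ^ (p - 2)) * ennreal (L * M)"
    by (intro mult_left_mono inv_fourier_L2 G M L) auto
  also have "\<dots> = ennreal (L ^ (p - 1) * M)"
  proof -
    have "p - 1 = Suc (p - 2)" using p by simp
    then show ?thesis using L0 M0 by (simp add: ennreal_mult[symmetric] mult_ac)
  qed
  finally show ?thesis .
qed

section \<open>Functions with bounded frequency support\<close>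

text \<open>Frequency support is expressed through an integrable density and not through
  \<open>fourier F\<close>: a sharply cut piece need not be integrable, and its Fourier integral
  would then be the default value 0.\<close>

definition band :: "real \<Rightarrow> real \<Rightarrow> (real \<Rightarrow> complex) \<Rightarrow> bool" where
  "band a b F \<longleftrightarrow> (\<exists>h. integrable lborel h \<and> (\<forall>\<xi>. h \<xi> \<noteq> 0 \<longrightarrow> a \<le> \<xi> \<and> \<xi> \<le> b) \<and> F = inv_fourier h)"

text \<open>Conjugation reflects frequencies; squared moduli contribute conjugated factors to the
  products treated below.\<close>

lemma band_cnj:
  assumes "band a b F" shows "band (- b) (- a) (\<lambda>x. cnj (F x))"
proof -
  obtain h where h: "integrable lborel h" "\<And>\<xi>. h \<xi> \<noteq> 0 \<Longrightarrow> a \<le> \<xi> \<and> \<xi> \<le> b" "F = inv_fourier h"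
    using assms by (auto simp: band_def)
  have "cnj (F x) = inv_fourier (\<lambda>\<xi>. cnj (h (- \<xi>))) x" for x
  proof -
    have "cnj (F x) = (LINT \<xi>|lborel. cnj (h \<xi> * e (x * \<xi>)))"
      unfolding h(3) inv_fourier_def by (rule Bochner_Integration.integral_cnj[symmetric])
    also have "\<dots> = (LINT \<xi>|lborel. cnj (h (- \<xi>) * e (x * (- \<xi>))))"
      by (subst lborel_integral_real_affine[where c="-1" and t=0]) auto
    finally show ?thesis by (simp add: inv_fourier_def cnj_e)
  qed
  moreover have "integrable lborel (\<lambda>\<xi>. cnj (h (- \<xi>)))"
    using lborel_integrable_real_affine[OF h(1), of "-1" 0] by simp
  moreover have "\<forall>\<xi>. cnj (h (- \<xi>)) \<noteq> 0 \<longrightarrow> - b \<le> \<xi> \<and> \<xi> \<le> - a"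
    using h(2) by fastforce
  ultimately show ?thesis unfolding band_def by blast
qed

lemma band_measurable:
  assumes "band a b F" shows "F \<in> borel_measurable borel"
proof -
  obtain h where h: "integrable lborel h" "F = inv_fourier h"
    using assms by (auto simp: band_def)
  then have "h \<in> borel_measurable borel" by auto
  then show ?thesis unfolding h by (rule inv_fourier_measurable)
qed

lemma band_bounded:
  assumes "band a b F" obtains C where "\<And>x. norm (F x) \<le> C"
  using assms norm_inv_fourier_le by (auto simp: band_def)

text \<open>From exp(-y) \<le> 1/y. What matters is the linear decay in \<open>s\<close> for fixed
  \<open>d\<close>: the frequency tail vanishes as the spatial Gaussian widens.\<close>

lemma gauss_tail:
  assumes "s > 0" "d > 0" shows "gauss (1 / s) d / s \<le> s / (pi * d\<^sup>2)"
proof -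
  define y where "y = pi * (d / s)\<^sup>2"
  have y: "y > 0" using assms by (simp add: y_def)
  have "exp (- y) \<le> 1 / y"
    using y order_trans[OF _ exp_ge_add_one_self, of y y] by (simp add: exp_minus field_simps)
  then have "gauss (1 / s) d / s \<le> (1 / y) / s"
    using assms by (intro divide_right_mono) (auto simp: gauss_def y_def)
  also have "\<dots> = s / (pi * d\<^sup>2)"
    using assms by (simp add: y_def field_simps power2_eq_square)
  finally show ?thesis .
qed

lemma band_prod_gauss_integrable:
  assumes "finite I" "\<And>i. i \<in> I \<Longrightarrow> band (a i) (b i) (F i)" "s > 0"
  shows "integrable lborel (\<lambda>x. (\<Prod>i\<in>I. F i x) * of_real (gauss s x) * e (- (x * \<eta>)))"
proof -
  have "\<forall>i. \<exists>C. i \<in> I \<longrightarrow> (\<forall>x. norm (F i x) \<le> C)"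
    using assms(2) band_bounded by metis
  then obtain C where C: "\<And>i x. i \<in> I \<Longrightarrow> norm (F i x) \<le> C i" by metis
  have [measurable]: "\<And>i. i \<in> I \<Longrightarrow> F i \<in> borel_measurable borel"
    using assms(2) band_measurable by blast
  show ?thesis
  proof (rule Bochner_Integration.integrable_bound)
    show "integrable lborel (\<lambda>x. (\<Prod>i\<in>I. C i) * gauss s x)"
      using gauss_integrable[of s] assms by simp
    show "AE x in lborel. norm ((\<Prod>i\<in>I. F i x) * of_real (gauss s x) * e (- (x * \<eta>)))
        \<le> norm ((\<Prod>i\<in>I. C i) * gauss s x)"
    proof (rule AE_I2)
      fix x
      have "(\<Prod>i\<in>I. norm (F i x)) \<le> (\<Prod>i\<in>I. C i)"
        by (intro prod_mono) (auto simp: C)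
      then show "norm ((\<Prod>i\<in>I. F i x) * of_real (gauss s x) * e (- (x * \<eta>)))
        \<le> norm ((\<Prod>i\<in>I. C i) * gauss s x)"
        using gauss_pos[of s x] by (auto simp: norm_mult prod_norm abs_mult intro: order_trans)
    qed
  qed measurable
qed

text \<open>Expresses that a product has its frequencies in the sum of the intervals. Writing the
  factor \<open>F j\<close> as a superposition of waves e(x \<xi>) with \<open>a j\<close> \<le>
  \<xi> \<le> \<open>b j\<close> moves \<eta> to \<eta> - \<xi>, which stays at least
  \<open>d\<close> outside the sum over the other factors; so the induction closes without
  convolutions. \<open>B\<close> is the product of the L^1 norms of the densities, and the empty
  product leaves the Gaussian itself.\<close>

lemma band_prod_gauss_decay:
  assumes "finite I" "\<And>i. i \<in> I \<Longrightarrow> band (a i) (b i) (F i)" "d \<ge> 0"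
  shows "\<exists>B\<ge>0. \<forall>s>0. \<forall>\<eta>. \<eta> \<le> (\<Sum>i\<in>I. a i) - d \<or> (\<Sum>i\<in>I. b i) + d \<le> \<eta> \<longrightarrow>
     norm (LINT x|lborel. (\<Prod>i\<in>I. F i x) * of_real (gauss s x) * e (- (x * \<eta>))) \<le> B * (gauss (1 / s) d / s)"
  using assms
proof (induction I rule: finite_induct)
  case empty
  have "norm (LINT x|lborel. of_real (gauss s x) * e (- (x * \<eta>))) \<le> gauss (1 / s) d / s"
    if "s > 0" "\<eta> \<le> - d \<or> d \<le> \<eta>" for s \<eta>
  proof -
    have "norm (LINT x|lborel. of_real (gauss s x) * e (- (x * \<eta>))) = gauss (1 / s) (- \<eta>) / s"
      using gauss_fourier[OF that(1), of "- \<eta>"] that gauss_pos[of "1 / s" "- \<eta>"]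
      by (simp add: norm_divide less_imp_le)
    also have "\<dots> \<le> gauss (1 / s) d / s"
      using that empty by (intro divide_right_mono gauss_antimono) auto
    finally show ?thesis .
  qed
  then show ?case by (intro exI[of _ 1]) auto
next
  case (insert j I)
  obtain B where B: "B \<ge> 0" and B': "\<And>s \<eta>. s > 0 \<Longrightarrow> \<eta> \<le> (\<Sum>i\<in>I. a i) - d \<or> (\<Sum>i\<in>I. b i) + d \<le> \<eta> \<Longrightarrow>
     norm (LINT x|lborel. (\<Prod>i\<in>I. F i x) * of_real (gauss s x) * e (- (x * \<eta>))) \<le> B * (gauss (1 / s) d / s)"
    using insert.IH insert.prems by auto
  obtain h where h: "integrable lborel h" "\<And>\<xi>. h \<xi> \<noteq> 0 \<Longrightarrow> a j \<le> \<xi> \<and> \<xi> \<le> b j" "F j = inv_fourier h"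
    using insert.prems(1)[of j] by (auto simp: band_def)
  let ?H = "LINT \<xi>|lborel. norm (h \<xi>)"
  show ?case
  proof (intro exI[of _ "B * ?H"] conjI allI impI)
    show "0 \<le> B * ?H" using B by simp
    fix s \<eta> :: real
    assume s: "s > 0" and \<eta>: "\<eta> \<le> (\<Sum>i\<in>insert j I. a i) - d \<or> (\<Sum>i\<in>insert j I. b i) + d \<le> \<eta>"
    let ?K = "B * (gauss (1 / s) d / s)"
    have "(LINT x|lborel. (\<Prod>i\<in>insert j I. F i x) * of_real (gauss s x) * e (- (x * \<eta>))) =
       (LINT x|lborel. ((\<Prod>i\<in>I. F i x) * of_real (gauss s x) * e (- (x * \<eta>))) * inv_fourier h x)"
      using insert.hyps by (simp add: h(3) mult_ac)
    also have "\<dots> = (LINT \<xi>|lborel. h \<xi> * (LINT x|lborel. ((\<Prod>i\<in>I. F i x) * of_real (gauss s x) * e (- (x * \<eta>))) * e (x * \<xi>)))"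
      by (rule integral_mult_inv_fourier[OF h(1) band_prod_gauss_integrable[where a=a and b=b]])
         (use insert s in auto)
    also have "\<dots> = (LINT \<xi>|lborel. h \<xi> * (LINT x|lborel. (\<Prod>i\<in>I. F i x) * of_real (gauss s x) * e (- (x * (\<eta> - \<xi>)))))"
      (is "_ = (LINT \<xi>|lborel. h \<xi> * ?J \<xi>)")
      by (simp add: mult.assoc e_add[symmetric] right_diff_distrib)
    also have "norm \<dots> \<le> (LINT \<xi>|lborel. norm (h \<xi>) * ?K)"
    proof (rule order_trans[OF integral_norm_bound integral_mono'])
      show "integrable lborel (\<lambda>\<xi>. norm (h \<xi>) * ?K)" using h(1) by simp
      show "norm (h \<xi> * ?J \<xi>) \<le> norm (h \<xi>) * ?K" for \<xi>
      proof (cases "h \<xi> = 0")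
        case False
        then have "a j \<le> \<xi> \<and> \<xi> \<le> b j" by (rule h(2))
        then have "norm (?J \<xi>) \<le> ?K"
          using \<eta> insert.hyps by (intro B' s) auto
        then show ?thesis by (simp only: norm_mult mult_left_mono norm_ge_zero)
      qed simp
      show "0 \<le> norm (h \<xi>) * ?K" for \<xi> using B s gauss_pos[THEN less_imp_le] by simp
    qed
    also have "\<dots> = B * ?H * (gauss (1 / s) d / s)" by simp
    finally show "norm (LINT x|lborel. (\<Prod>i\<in>insert j I. F i x) * of_real (gauss s x) * e (- (x * \<eta>)))
      \<le> B * ?H * (gauss (1 / s) d / s)" .
  qed
qed

text \<open>The integral is the transform of the product at frequency 0, and \<open>d\<close> is a
  gap between 0 and the summed interval. With a Gaussian inserted it is O(s) by the decay estimate;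
  without, it is the limit for s tending to 0 by dominated convergence.\<close>

lemma band_prod_integral_eq_0:
  assumes I: "finite I" and band: "\<And>i. i \<in> I \<Longrightarrow> band (a i) (b i) (F i)"
    and pos: "(\<Sum>i\<in>I. a i) > 0 \<or> (\<Sum>i\<in>I. b i) < 0"
    and int: "integrable lborel (\<lambda>x. \<Prod>i\<in>I. F i x)"
  shows "(LINT x|lborel. (\<Prod>i\<in>I. F i x)) = 0"
proof -
  obtain d where d: "d > 0" "0 \<le> (\<Sum>i\<in>I. a i) - d \<or> (\<Sum>i\<in>I. b i) + d \<le> 0"
    using pos by (metis diff_self order_refl add.right_inverse neg_0_less_iff_less)
  have "\<exists>B\<ge>0. \<forall>s>0. \<forall>\<eta>. \<eta> \<le> (\<Sum>i\<in>I. a i) - d \<or> (\<Sum>i\<in>I. b i) + d \<le> \<eta> \<longrightarrow>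
     norm (LINT x|lborel. (\<Prod>i\<in>I. F i x) * of_real (gauss s x) * e (- (x * \<eta>))) \<le> B * (gauss (1 / s) d / s)"
    by (rule band_prod_gauss_decay) (use I band d(1) in auto)
  then obtain B where B: "B \<ge> 0" "\<And>s \<eta>. s > 0 \<Longrightarrow> \<eta> \<le> (\<Sum>i\<in>I. a i) - d \<or> (\<Sum>i\<in>I. b i) + d \<le> \<eta> \<Longrightarrow>
     norm (LINT x|lborel. (\<Prod>i\<in>I. F i x) * of_real (gauss s x) * e (- (x * \<eta>))) \<le> B * (gauss (1 / s) d / s)"
    by blast
  let ?s = "\<lambda>m. 1 / real (Suc m)"
  let ?g = "\<lambda>m. LINT x|lborel. (\<Prod>i\<in>I. F i x) * of_real (gauss (?s m) x)"
  have s0: "?s \<longlonglongrightarrow> 0"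
    using LIMSEQ_inverse_real_of_nat by (simp add: inverse_eq_divide)
  have "?g \<longlonglongrightarrow> (LINT x|lborel. (\<Prod>i\<in>I. F i x))"
  proof (rule integral_dominated_convergence)
    have [measurable]: "(\<lambda>x. \<Prod>i\<in>I. F i x) \<in> borel_measurable borel" using int by auto
    show "(\<lambda>x. \<Prod>i\<in>I. F i x) \<in> borel_measurable lborel" by measurable
    show "(\<lambda>x. (\<Prod>i\<in>I. F i x) * of_real (gauss (?s m) x)) \<in> borel_measurable lborel" for m
      by measurable
    show "integrable lborel (\<lambda>x. norm (\<Prod>i\<in>I. F i x))" using int by simp
    show "AE x in lborel. (\<lambda>m. (\<Prod>i\<in>I. F i x) * of_real (gauss (?s m) x)) \<longlonglongrightarrow> (\<Prod>i\<in>I. F i x)"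
    proof (rule AE_I2)
      fix x
      have "(\<lambda>m. gauss (?s m) x) \<longlonglongrightarrow> exp (- (pi * (0 * x)\<^sup>2))"
        unfolding gauss_def using s0 by (intro tendsto_intros)
      then have "(\<lambda>m. (\<Prod>i\<in>I. F i x) * of_real (gauss (?s m) x)) \<longlonglongrightarrow> (\<Prod>i\<in>I. F i x) * of_real (exp (- (pi * (0 * x)\<^sup>2)))"
        by (intro tendsto_intros)
      then show "(\<lambda>m. (\<Prod>i\<in>I. F i x) * of_real (gauss (?s m) x)) \<longlonglongrightarrow> (\<Prod>i\<in>I. F i x)"
        by simp
    qed
    show "AE x in lborel. norm ((\<Prod>i\<in>I. F i x) * of_real (gauss (?s m) x)) \<le> norm (\<Prod>i\<in>I. F i x)" for m
      using gauss_pos[of "?s m"] gauss_le_1[of "?s m"]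
      by (intro AE_I2) (auto simp: norm_mult less_imp_le intro!: mult_left_le)
  qed
  moreover have "?g \<longlonglongrightarrow> 0"
  proof (rule Lim_null_comparison)
    show "\<forall>\<^sub>F m in sequentially. norm (?g m) \<le> B * (?s m / (pi * d\<^sup>2))"
    proof (intro always_eventually allI)
      fix m
      have "norm (?g m) \<le> B * (gauss (1 / ?s m) d / ?s m)"
        using B(2)[of "?s m" 0] d(2) by simp
      also have "\<dots> \<le> B * (?s m / (pi * d\<^sup>2))"
        using B(1) d(1) by (intro mult_left_mono gauss_tail) auto
      finally show "norm (?g m) \<le> B * (?s m / (pi * d\<^sup>2))" .
    qed
    have "(\<lambda>m. B * (?s m / (pi * d\<^sup>2))) \<longlonglongrightarrow> B * (0 / (pi * d\<^sup>2))"
      using d(1) by (intro tendsto_intros s0) auto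
    then show "(\<lambda>m. B * (?s m / (pi * d\<^sup>2))) \<longlonglongrightarrow> 0" by simp
  qed
  ultimately show ?thesis using LIMSEQ_unique by blast
qed

text \<open>The inequality of arithmetic and geometric means, applied pointwise to |F_i(x)| / c_i
  and integrated. The division is the reason for strictly positive \<open>c i\<close>.\<close>

lemma nn_integral_prod_Holder:
  fixes F :: "'i \<Rightarrow> 'a \<Rightarrow> complex"
  assumes I: "finite I" "I \<noteq> {}" and F: "\<And>i. i \<in> I \<Longrightarrow> F i \<in> borel_measurable M"
    and c: "\<And>i. i \<in> I \<Longrightarrow> c i > 0"
    and le: "\<And>i. i \<in> I \<Longrightarrow> (\<integral>\<^sup>+x. ennreal (norm (F i x) ^ card I) \<partial>M) \<le> ennreal (c i ^ card I)"
  shows "(\<integral>\<^sup>+x. ennreal (norm (\<Prod>i\<in>I. F i x)) \<partial>M) \<le> ennreal (\<Prod>i\<in>I. c i)"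
proof -
  let ?p = "card I"
  have p: "?p > 0" using I by (simp add: card_gt_0_iff)
  have C: "(\<Prod>i\<in>I. c i) > 0" using c by (simp add: prod_pos)
  note [measurable] = F
  have am: "(\<Prod>i\<in>I. y i) \<le> (\<Sum>i\<in>I. y i ^ ?p / ?p)" if "\<And>i. i \<in> I \<Longrightarrow> y i \<ge> 0" for y :: "'i \<Rightarrow> real"
  proof -
    have "(\<Prod>i\<in>I. y i ^ ?p) powr (1 / ?p) = (\<Prod>i\<in>I. y i)"
      using p that by (simp add: prod_power_distrib[symmetric] root_powr_inverse[symmetric] real_root_power_cancel prod_nonneg)
    then show ?thesis using arith_geom_mean[OF I, of "\<lambda>i. y i ^ ?p"] that by simp
  qed
  have pw: "ennreal (norm (\<Prod>i\<in>I. F i x)) \<le>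
      (\<Sum>i\<in>I. ennreal ((\<Prod>i\<in>I. c i) / (c i ^ ?p * ?p)) * ennreal (norm (F i x) ^ ?p))" for x
  proof -
    have "norm (\<Prod>i\<in>I. F i x) = (\<Prod>i\<in>I. c i) * (\<Prod>i\<in>I. norm (F i x) / c i)"
      using C by (simp add: prod_dividef prod_norm)
    also have "\<dots> \<le> (\<Prod>i\<in>I. c i) * (\<Sum>i\<in>I. (norm (F i x) / c i) ^ ?p / ?p)"
      using C c by (intro mult_left_mono am) (auto simp: less_imp_le)
    also have "\<dots> = (\<Sum>i\<in>I. ((\<Prod>i\<in>I. c i) / (c i ^ ?p * ?p)) * norm (F i x) ^ ?p)"
      by (simp add: sum_distrib_left power_divide field_simps)
    finally have "ennreal (norm (\<Prod>i\<in>I. F i x)) \<le> ennreal (\<Sum>i\<in>I. ((\<Prod>i\<in>I. c i) / (c i ^ ?p * ?p)) * norm (F i x) ^ ?p)"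
      by (rule ennreal_leI)
    also have "\<dots> = (\<Sum>i\<in>I. ennreal (((\<Prod>i\<in>I. c i) / (c i ^ ?p * ?p)) * norm (F i x) ^ ?p))"
      using C c by (intro sum_ennreal[symmetric]) (auto simp: less_imp_le)
    also have "\<dots> = (\<Sum>i\<in>I. ennreal ((\<Prod>i\<in>I. c i) / (c i ^ ?p * ?p)) * ennreal (norm (F i x) ^ ?p))"
      using C c by (intro sum.cong refl ennreal_mult) (auto simp: less_imp_le)
    finally show ?thesis .
  qed
  have "(\<integral>\<^sup>+x. ennreal (norm (\<Prod>i\<in>I. F i x)) \<partial>M) \<le>
     (\<integral>\<^sup>+x. (\<Sum>i\<in>I. ennreal ((\<Prod>i\<in>I. c i) / (c i ^ ?p * ?p)) * ennreal (norm (F i x) ^ ?p)) \<partial>M)"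
    by (intro nn_integral_mono pw)
  also have "\<dots> = (\<Sum>i\<in>I. ennreal ((\<Prod>i\<in>I. c i) / (c i ^ ?p * ?p)) * (\<integral>\<^sup>+x. ennreal (norm (F i x) ^ ?p) \<partial>M))"
    by (subst nn_integral_sum) (auto intro!: sum.cong nn_integral_cmult)
  also have "\<dots> \<le> (\<Sum>i\<in>I. ennreal ((\<Prod>i\<in>I. c i) / (c i ^ ?p * ?p)) * ennreal (c i ^ ?p))"
    by (intro sum_mono mult_left_mono le) auto
  also have "\<dots> = (\<Sum>i\<in>I. ennreal ((\<Prod>i\<in>I. c i) / ?p))"
    using C c by (intro sum.cong refl) (simp add: ennreal_mult[symmetric] less_imp_le order_less_imp_not_eq2)
  also have "\<dots> = ennreal (\<Sum>i\<in>I. (\<Prod>i\<in>I. c i) / ?p)"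
    using C by (intro sum_ennreal) auto
  also have "(\<Sum>i\<in>I. (\<Prod>i\<in>I. c i) / ?p) = (\<Prod>i\<in>I. c i)"
    using p by simp
  finally show ?thesis .
qed

section \<open>Even moments of trigonometric sums\<close>

text \<open>The n-fold additive energy of \<open>S\<close> with weights \<open>c\<close>: solutions
  of t_1 + ... + t_n = u_1 + ... + u_n in \<open>S\<close>. The extensional function space makes
  each tuple occur once.\<close>

definition energy :: "int set \<Rightarrow> nat \<Rightarrow> (int \<Rightarrow> real) \<Rightarrow> real" where
  "energy S n c = (\<Sum>t\<in>{..<n} \<rightarrow>\<^sub>E S. \<Sum>u\<in>{..<n} \<rightarrow>\<^sub>E S.
     if (\<Sum>i<n. t i) = (\<Sum>i<n. u i) then (\<Prod>i<n. c (t i)) * (\<Prod>i<n. c (u i)) else 0)"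

lemma norm_sum_square:
  fixes z :: "'a \<Rightarrow> complex"
  shows "of_real ((norm (\<Sum>t\<in>T. z t))\<^sup>2) = (\<Sum>t\<in>T. \<Sum>u\<in>T. z t * cnj (z u))"
  by (simp only: complex_norm_square cnj_sum sum_product)

lemma sum_power_tuples:
  fixes z :: "'a \<Rightarrow> complex"
  assumes "finite S"
  shows "(\<Sum>l\<in>S. z l) ^ n = (\<Sum>t\<in>{..<n} \<rightarrow>\<^sub>E S. \<Prod>i<n. z (t i))"
  using prod_sum_PiE[of "{..<n}" "\<lambda>_. S" "\<lambda>_. z"] assms by simp

lemma e_sum: "finite I \<Longrightarrow> (\<Prod>i\<in>I. e (f i)) = e (\<Sum>i\<in>I. f i)"
  by (induction I rule: finite_induct) (auto simp: e_add)

lemma e_int [simp]: "e (of_int m) = 1"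
  using exp_integer_2pi[of "of_int m"] by (simp add: e_def mult_ac)

lemma has_bochner_integral_e_int:
  "has_bochner_integral (restrict_space lborel {0..1}) (\<lambda>x. e (of_int m * x)) (if m = 0 then 1 else 0)"
proof -
  have int: "integrable (restrict_space lborel {0..1::real}) (\<lambda>x. e (of_int m * x))"
    by (subst integrable_restrict_space)
       (auto intro!: borel_integrable_compact continuous_intros)
  have "(LINT x|lborel. indicator {0..1} x *\<^sub>R e (of_int m * x)) = (if m = 0 then 1 else 0)"
  proof (cases "m = 0")
    case True
    then have "(LINT x|lborel. indicator {0..1} x *\<^sub>R e (of_int m * x)) = complex_of_real 1 - complex_of_real 0"
      by (intro integral_FTC_atLeastAtMost) (auto intro!: derivative_eq_intros continuous_intros)
    with True show ?thesis by simp
  next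
    case False
    let ?F = "\<lambda>x. e (of_int m * x) / (2 * pi * \<i> * of_int m)"
    have "(LINT x|lborel. indicator {0..1} x *\<^sub>R e (of_int m * x)) = ?F 1 - ?F 0"
    proof (intro integral_FTC_atLeastAtMost)
      show "(?F has_vector_derivative e (of_int m * x)) (at x within {0..1})" for x
        unfolding e_def using False
        by (auto intro!: derivative_eq_intros has_vector_derivative_real_field)
    qed (auto intro!: continuous_intros)
    with False show ?thesis using e_int[of m] by simp
  qed
  with int show ?thesis
    by (simp add: has_bochner_integral_iff integral_restrict_space)
qed

text \<open>The 2n-th power of the modulus is the n-th power times its conjugate; orthogonality of
  characters keeps exactly the pairs of tuples with equal sums. Being an identity, it serves both
  directions of the comparison.\<close>

lemma trig_moment:
  assumes S: "finite S"
  shows "(\<integral>\<^sup>+x. ennreal (norm (\<Sum>l\<in>S. of_real (c l) * e (of_int l * x)) ^ (2 * n))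
            \<partial>restrict_space lborel {0..1}) = ennreal (energy S n c)"
proof -
  let ?M = "restrict_space lborel {0..1::real}"
  let ?T = "{..<n} \<rightarrow>\<^sub>E S"
  let ?P = "\<lambda>x. \<Sum>l\<in>S. of_real (c l) * e (of_int l * x) :: complex"
  let ?z = "\<lambda>t x. complex_of_real (\<Prod>i<n. c (t i)) * e (of_int (\<Sum>i<n. t i) * x)"
  have P: "complex_of_real (norm (?P x) ^ (2 * n)) = (\<Sum>t\<in>?T. \<Sum>u\<in>?T.
     of_real ((\<Prod>i<n. c (t i)) * (\<Prod>i<n. c (u i))) * e (of_int ((\<Sum>i<n. t i) - (\<Sum>i<n. u i)) * x))" for x
  proof -
    have "?P x ^ n = (\<Sum>t\<in>?T. ?z t x)"
      by (simp only: sum_power_tuples[OF S] prod.distrib e_sum finite_lessThan of_real_prod of_int_sum sum_distrib_right)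
    moreover have "norm (?P x) ^ (2 * n) = (norm (?P x ^ n))\<^sup>2"
      by (simp only: norm_power power_mult[symmetric] mult.commute)
    ultimately have "complex_of_real (norm (?P x) ^ (2 * n)) = of_real ((norm (\<Sum>t\<in>?T. ?z t x))\<^sup>2)"
      by (simp only:)
    also have "\<dots> = (\<Sum>t\<in>?T. \<Sum>u\<in>?T. ?z t x * cnj (?z u x))"
      by (rule norm_sum_square)
    also have "\<dots> = (\<Sum>t\<in>?T. \<Sum>u\<in>?T.
     of_real ((\<Prod>i<n. c (t i)) * (\<Prod>i<n. c (u i))) * e (of_int ((\<Sum>i<n. t i) - (\<Sum>i<n. u i)) * x))"
    proof (intro sum.cong refl)
      fix t u
      have "e (of_int ((\<Sum>i<n. t i) - (\<Sum>i<n. u i)) * x) = e (of_int (\<Sum>i<n. t i) * x) * cnj (e (of_int (\<Sum>i<n. u i) * x))"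
        by (simp only: cnj_e e_add[symmetric]) (simp add: left_diff_distrib)
      then show "?z t x * cnj (?z u x) = of_real ((\<Prod>i<n. c (t i)) * (\<Prod>i<n. c (u i))) * e (of_int ((\<Sum>i<n. t i) - (\<Sum>i<n. u i)) * x)"
        by (simp add: mult_ac)
    qed
    finally show ?thesis .
  qed
  have "has_bochner_integral ?M (\<lambda>x. complex_of_real (norm (?P x) ^ (2 * n)))
     (\<Sum>t\<in>?T. \<Sum>u\<in>?T. of_real ((\<Prod>i<n. c (t i)) * (\<Prod>i<n. c (u i))) *
       (if (\<Sum>i<n. t i) - (\<Sum>i<n. u i) = 0 then 1 else 0))"
    unfolding P
    by (intro has_bochner_integral_sum has_bochner_integral_mult_right has_bochner_integral_e_int)
  also have "(\<Sum>t\<in>?T. \<Sum>u\<in>?T. of_real ((\<Prod>i<n. c (t i)) * (\<Prod>i<n. c (u i))) *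
       (if (\<Sum>i<n. t i) - (\<Sum>i<n. u i) = 0 then 1 else 0)) = complex_of_real (energy S n c)"
    unfolding energy_def of_real_sum by (intro sum.cong refl) auto
  finally have "has_bochner_integral ?M (\<lambda>x. norm (?P x) ^ (2 * n)) (energy S n c)"
    using has_bochner_integral_Re by fastforce
  then show ?thesis
    using nn_integral_eq_integral[of ?M "\<lambda>x. norm (?P x) ^ (2 * n)"]
    by (simp add: has_bochner_integral_iff)
qed

text \<open>A product of \<open>n\<close> of the functions has its frequencies in an interval of length \<open>n / N\<close>
  starting at a multiple of \<open>1 / N\<close>. Tuples whose sums agree modulo \<open>n + 1\<close> without being equal
  therefore give orthogonal products, and splitting into residue classes loses only a factor \<open>n + 1\<close>.\<close>

lemma even_decoupling:
  fixes S :: "int set" and f :: "int \<Rightarrow> real \<Rightarrow> complex" and c :: "int \<Rightarrow> real"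
  assumes S: "finite S" and n: "n \<ge> 1" and N: "N > 0"
    and f: "\<And>l. l \<in> S \<Longrightarrow> band (of_int l / N) ((of_int l + 1) / N) (f l)"
    and c: "\<And>l. l \<in> S \<Longrightarrow> c l > 0"
    and le: "\<And>l. l \<in> S \<Longrightarrow> (\<integral>\<^sup>+x. ennreal (norm (f l x) ^ (2 * n)) \<partial>lborel) \<le> ennreal (c l ^ (2 * n))"
  shows "(\<integral>\<^sup>+x. ennreal (norm (\<Sum>l\<in>S. f l x) ^ (2 * n)) \<partial>lborel) \<le> ennreal ((real n + 1) * energy S n c)"
proof -
  let ?T = "{..<n} \<rightarrow>\<^sub>E S"
  let ?\<sigma> = "\<lambda>t :: nat \<Rightarrow> int. \<Sum>i<n. t i"
  let ?c = "\<lambda>t :: nat \<Rightarrow> int. \<Prod>i<n. c (t i)"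
  let ?z = "\<lambda>t x. \<Prod>i<n. f (t i) x"
  \<comment> \<open>The disjoint sum indexes the 2n factors belonging to a pair of tuples: left
    copies carry the pieces of \<open>t\<close>, right copies the conjugated pieces of
    \<open>u\<close>. Hoelder's bound and the vanishing criterion then apply to one family.\<close>
  let ?I = "{..<n} <+> {..<n}"
  define F where "F t u = case_sum (\<lambda>i. f (t i)) (\<lambda>i x. cnj (f (u i) x))" for t u :: "nat \<Rightarrow> int"
  define a where "a t u = case_sum (\<lambda>i. of_int (t i) / N) (\<lambda>i. - ((of_int (u i) + 1) / N))" for t u :: "nat \<Rightarrow> int"
  define b where "b t u = case_sum (\<lambda>i. (of_int (t i) + 1) / N) (\<lambda>i. - (of_int (u i) / N))" for t u :: "nat \<Rightarrow> int"
  define d where "d t u = case_sum (\<lambda>i. c (t i)) (\<lambda>i. c (u i))" for t u :: "nat \<Rightarrow> int"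
  have T: "finite ?T" using S by (intro finite_PiE) auto
  have TS: "t i \<in> S" if "t \<in> ?T" "i < n" for t i using that by auto
  have cardI: "card ?I = 2 * n" by (simp add: card_Plus)
  have prodF: "(\<Prod>i\<in>?I. F t u i x) = ?z t x * cnj (?z u x)" for t u x
    by (simp add: prod.Plus F_def)
  have bandF: "band (a t u i) (b t u i) (F t u i)" if "t \<in> ?T" "u \<in> ?T" "i \<in> ?I" for t u i
    using that f[OF TS[OF that(1)]] band_cnj[OF f[OF TS[OF that(2)]]]
    by (auto simp: a_def b_def F_def)
  have zint: "integrable lborel (\<lambda>x. ?z t x * cnj (?z u x))"
    and zle: "norm (LINT x|lborel. ?z t x * cnj (?z u x)) \<le> ?c t * ?c u"
    if tu: "t \<in> ?T" "u \<in> ?T" for t u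
  proof -
    have [measurable]: "\<And>i. i \<in> ?I \<Longrightarrow> F t u i \<in> borel_measurable borel"
      using bandF[OF tu] band_measurable by blast
    have "(\<integral>\<^sup>+x. ennreal (norm (\<Prod>i\<in>?I. F t u i x)) \<partial>lborel) \<le> ennreal (\<Prod>i\<in>?I. d t u i)"
    proof (rule nn_integral_prod_Holder)
      show "?I \<noteq> {}" using n by (auto simp: lessThan_empty_iff)
      show "(\<integral>\<^sup>+x. ennreal (norm (F t u i x) ^ card ?I) \<partial>lborel) \<le> ennreal (d t u i ^ card ?I)"
        if "i \<in> ?I" for i
        unfolding cardI using that le[OF TS[OF tu(1)]] le[OF TS[OF tu(2)]] by (auto simp: F_def d_def)
      show "d t u i > 0" if "i \<in> ?I" for i
        using that c[OF TS[OF tu(1)]] c[OF TS[OF tu(2)]] by (auto simp: d_def)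
    qed auto
    moreover have "(\<Prod>i\<in>?I. d t u i) = ?c t * ?c u" by (simp add: prod.Plus d_def)
    ultimately have *: "(\<integral>\<^sup>+x. ennreal (norm (\<Prod>i\<in>?I. F t u i x)) \<partial>lborel) \<le> ennreal (?c t * ?c u)" by simp
    have int: "integrable lborel (\<lambda>x. \<Prod>i\<in>?I. F t u i x)"
    proof (rule integrableI_bounded)
      show "(\<integral>\<^sup>+x. ennreal (norm (\<Prod>i\<in>?I. F t u i x)) \<partial>lborel) < \<infinity>"
        using * by (rule le_less_trans) simp
    qed measurable
    then show "integrable lborel (\<lambda>x. ?z t x * cnj (?z u x))" by (simp only: prodF)
    have "?c t * ?c u \<ge> 0"
      using c TS tu by (intro mult_nonneg_nonneg prod_nonneg) (auto intro: less_imp_le)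
    moreover have "ennreal (LINT x|lborel. norm (\<Prod>i\<in>?I. F t u i x)) \<le> ennreal (?c t * ?c u)"
      using * int by (subst nn_integral_eq_integral[symmetric]) auto
    ultimately have "(LINT x|lborel. norm (\<Prod>i\<in>?I. F t u i x)) \<le> ?c t * ?c u"
      by (simp add: ennreal_le_iff)
    with integral_norm_bound[of lborel "\<lambda>x. \<Prod>i\<in>?I. F t u i x"]
    have "norm (LINT x|lborel. (\<Prod>i\<in>?I. F t u i x)) \<le> ?c t * ?c u" by linarith
    then show "norm (LINT x|lborel. ?z t x * cnj (?z u x)) \<le> ?c t * ?c u" by (simp only: prodF)
  qed
  have z0: "(LINT x|lborel. ?z t x * cnj (?z u x)) = 0"
    if tu: "t \<in> ?T" "u \<in> ?T" and ne: "?\<sigma> t \<noteq> ?\<sigma> u" and r: "?\<sigma> t mod int (n + 1) = ?\<sigma> u mod int (n + 1)" for t u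
  proof -
    \<comment> \<open>Distinct congruent sums are at least n+1 apart, while the product has its
      frequencies within n/N of (\<sigma> t - \<sigma> u)/N. A gap of 1/N to the frequency 0
      remains; with modulus n the interval could touch 0.\<close>
    have "int (n + 1) dvd ?\<sigma> t - ?\<sigma> u" using r by (rule mod_eq_dvd_iff[THEN iffD1])
    then have "int (n + 1) \<le> \<bar>?\<sigma> t - ?\<sigma> u\<bar>" using ne dvd_imp_le_int[of "?\<sigma> t - ?\<sigma> u" "int (n + 1)"] by linarith
    then consider "?\<sigma> t - ?\<sigma> u - int n > 0" | "?\<sigma> t - ?\<sigma> u + int n < 0" by linarith
    then have sgn: "real_of_int (?\<sigma> t - ?\<sigma> u - int n) > 0 \<or> real_of_int (?\<sigma> t - ?\<sigma> u + int n) < 0"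
      by (cases; simp only: of_int_0_less_iff of_int_less_0_iff simp_thms)
    have sa: "(\<Sum>i\<in>?I. a t u i) = real_of_int (?\<sigma> t - ?\<sigma> u - int n) / N"
      by (simp add: sum.Plus a_def sum_divide_distrib[symmetric] sum_negf sum.distrib sum_subtractf diff_divide_distrib add_divide_distrib)
    have sb: "(\<Sum>i\<in>?I. b t u i) = real_of_int (?\<sigma> t - ?\<sigma> u + int n) / N"
      by (simp add: sum.Plus b_def sum_divide_distrib[symmetric] sum_negf sum.distrib sum_subtractf diff_divide_distrib add_divide_distrib)
    have "(LINT x|lborel. (\<Prod>i\<in>?I. F t u i x)) = 0"
    proof (rule band_prod_integral_eq_0[where a="a t u" and b="b t u"])
      show "(\<Sum>i\<in>?I. a t u i) > 0 \<or> (\<Sum>i\<in>?I. b t u i) < 0"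
        unfolding sa sb using sgn N by (auto simp: divide_less_0_iff)
      show "integrable lborel (\<lambda>x. \<Prod>i\<in>?I. F t u i x)"
        using zint[OF tu] by (simp only: prodF)
    qed (use bandF[OF tu] in auto)
    then show ?thesis by (simp only: prodF)
  qed
  define R where "R r = {t\<in>?T. ?\<sigma> t mod int (n + 1) = r}" for r
  have Rfin: "finite (R r)" for r using T by (simp add: R_def)
  let ?Q = "{0..<int (n + 1)}"
  have img: "(\<lambda>t. ?\<sigma> t mod int (n + 1)) ` ?T \<subseteq> ?Q"
    by (intro image_subsetI) simp
  have split: "sum g ?T = (\<Sum>r\<in>?Q. sum g (R r))" for g :: "(nat \<Rightarrow> int) \<Rightarrow> 'b::comm_monoid_add"
    unfolding R_def by (rule sum.group[OF T _ img, symmetric]) simp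
  let ?e = "\<lambda>t u. if ?\<sigma> t = ?\<sigma> u then ?c t * ?c u else 0"
  have part: "(\<integral>\<^sup>+x. ennreal ((norm (\<Sum>t\<in>R r. ?z t x))\<^sup>2) \<partial>lborel) \<le> ennreal (\<Sum>t\<in>R r. \<Sum>u\<in>R r. ?e t u)" for r
  proof -
    let ?g = "\<lambda>x. \<Sum>t\<in>R r. \<Sum>u\<in>R r. ?z t x * cnj (?z u x)"
    have gint: "integrable lborel ?g"
      by (intro Bochner_Integration.integrable_sum zint) (auto simp: R_def)
    have gre: "?g x = of_real ((norm (\<Sum>t\<in>R r. ?z t x))\<^sup>2)" for x
      by (rule norm_sum_square[symmetric])
    have int: "integrable lborel (\<lambda>x. (norm (\<Sum>t\<in>R r. ?z t x))\<^sup>2)"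
      using integrable_Re[OF gint] unfolding gre by (simp only: Re_complex_of_real)
    have "of_real (LINT x|lborel. (norm (\<Sum>t\<in>R r. ?z t x))\<^sup>2) = (LINT x|lborel. ?g x)"
      unfolding gre by (rule integral_complex_of_real[symmetric])
    also have "\<dots> = (\<Sum>t\<in>R r. \<Sum>u\<in>R r. (LINT x|lborel. ?z t x * cnj (?z u x)))"
    proof -
      have i: "t \<in> R r \<Longrightarrow> u \<in> R r \<Longrightarrow> integrable lborel (\<lambda>x. ?z t x * cnj (?z u x))" for t u
        by (rule zint) (auto simp: R_def)
      show ?thesis
        by (subst Bochner_Integration.integral_sum, intro Bochner_Integration.integrable_sum i, assumption+)
           (intro sum.cong refl Bochner_Integration.integral_sum i, assumption+)
    qed
    finally have "(LINT x|lborel. (norm (\<Sum>t\<in>R r. ?z t x))\<^sup>2) \<le> norm (\<Sum>t\<in>R r. \<Sum>u\<in>R r. (LINT x|lborel. ?z t x * cnj (?z u x)))"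
      by (rule of_real_eq_imp_le_norm)
    \<comment> \<open>Within a residue class an integral either vanishes or belongs to a pair with
      equal sums, where Hoelder gives the matching term of the energy.\<close>
    also have "\<dots> \<le> (\<Sum>t\<in>R r. \<Sum>u\<in>R r. ?e t u)"
    proof (intro order_trans[OF norm_sum] sum_mono)
      fix t u assume *: "t \<in> R r" "u \<in> R r"
      then show "norm (LINT x|lborel. ?z t x * cnj (?z u x)) \<le> ?e t u"
        using zle[of t u] z0[of t u] by (auto simp: R_def)
    qed
    finally have "(LINT x|lborel. (norm (\<Sum>t\<in>R r. ?z t x))\<^sup>2) \<le> (\<Sum>t\<in>R r. \<Sum>u\<in>R r. ?e t u)" .
    then show ?thesis
      using nn_integral_eq_integral[OF int] by (simp add: ennreal_leI)
  qed
  have zm [measurable]: "t \<in> ?T \<Longrightarrow> (\<lambda>x. ?z t x) \<in> borel_measurable borel" for t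
    using TS[of t] f band_measurable by (intro borel_measurable_prod) blast
  have pw: "ennreal (norm (\<Sum>l\<in>S. f l x) ^ (2 * n)) \<le>
      (\<Sum>r\<in>?Q. ennreal (real n + 1) * ennreal ((norm (\<Sum>t\<in>R r. ?z t x))\<^sup>2))" for x
  proof -
    have "norm (\<Sum>l\<in>S. f l x) ^ (2 * n) = (norm ((\<Sum>l\<in>S. f l x) ^ n))\<^sup>2"
      by (simp add: norm_power power_mult[symmetric] mult.commute)
    also have "(\<Sum>l\<in>S. f l x) ^ n = (\<Sum>r\<in>?Q. \<Sum>t\<in>R r. ?z t x)"
      by (simp only: sum_power_tuples[OF S] split)
    also have "(norm (\<Sum>r\<in>?Q. \<Sum>t\<in>R r. ?z t x))\<^sup>2 \<le> (\<Sum>r\<in>?Q. norm (\<Sum>t\<in>R r. ?z t x))\<^sup>2"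
      by (intro power_mono norm_sum) auto
    \<comment> \<open>Cauchy-Schwarz over the residue classes, the source of the factor
      \<open>n + 1\<close>.\<close>
    also have "\<dots> \<le> real (card ?Q) * (\<Sum>r\<in>?Q. (norm (\<Sum>t\<in>R r. ?z t x))\<^sup>2)"
      using sum_squared_le_sum_of_squares[of "\<lambda>r. norm (\<Sum>t\<in>R r. ?z t x)" ?Q] by (simp add: mult.commute)
    also have "\<dots> = (\<Sum>r\<in>?Q. (real n + 1) * (norm (\<Sum>t\<in>R r. ?z t x))\<^sup>2)"
      by (simp add: sum_distrib_left add.commute)
    finally have "ennreal (norm (\<Sum>l\<in>S. f l x) ^ (2 * n)) \<le> ennreal (\<Sum>r\<in>?Q. (real n + 1) * (norm (\<Sum>t\<in>R r. ?z t x))\<^sup>2)"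
      by (rule ennreal_leI)
    also have "\<dots> = (\<Sum>r\<in>?Q. ennreal ((real n + 1) * (norm (\<Sum>t\<in>R r. ?z t x))\<^sup>2))"
      by (rule sum_ennreal[symmetric]) simp
    also have "\<dots> = (\<Sum>r\<in>?Q. ennreal (real n + 1) * ennreal ((norm (\<Sum>t\<in>R r. ?z t x))\<^sup>2))"
      by (intro sum.cong refl ennreal_mult) auto
    finally show ?thesis .
  qed
  have enn: "0 \<le> (\<Sum>t\<in>R r. \<Sum>u\<in>R r. ?e t u)" for r
  proof -
    have "?c t \<ge> 0" if "t \<in> R r" for t
      using that c TS by (intro prod_nonneg) (auto simp: R_def intro: less_imp_le)
    then show ?thesis by (intro sum_nonneg) auto
  qed
  have mR[measurable]: "(\<lambda>x. \<Sum>t\<in>R r. ?z t x) \<in> borel_measurable borel" for r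
    by (intro borel_measurable_sum zm) (auto simp: R_def)
  have "(\<integral>\<^sup>+x. ennreal (norm (\<Sum>l\<in>S. f l x) ^ (2 * n)) \<partial>lborel) \<le>
     (\<integral>\<^sup>+x. (\<Sum>r\<in>?Q. ennreal (real n + 1) * ennreal ((norm (\<Sum>t\<in>R r. ?z t x))\<^sup>2)) \<partial>lborel)"
    by (intro nn_integral_mono pw)
  also have "\<dots> = (\<Sum>r\<in>?Q. ennreal (real n + 1) * (\<integral>\<^sup>+x. ennreal ((norm (\<Sum>t\<in>R r. ?z t x))\<^sup>2) \<partial>lborel))"
    by (subst nn_integral_sum) (auto intro!: sum.cong nn_integral_cmult)
  also have "\<dots> \<le> (\<Sum>r\<in>?Q. ennreal (real n + 1) * ennreal (\<Sum>t\<in>R r. \<Sum>u\<in>R r. ?e t u))"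
    by (intro sum_mono mult_left_mono part) auto
  also have "\<dots> = ennreal (\<Sum>r\<in>?Q. (real n + 1) * (\<Sum>t\<in>R r. \<Sum>u\<in>R r. ?e t u))"
    by (simp only: sum_ennreal[symmetric] ennreal_mult enn mult_nonneg_nonneg add_nonneg_nonneg
        of_nat_0_le_iff zero_le_one)
  also have "(\<Sum>r\<in>?Q. (real n + 1) * (\<Sum>t\<in>R r. \<Sum>u\<in>R r. ?e t u)) = (real n + 1) * energy S n c"
  proof -
    have "energy S n c = (\<Sum>r\<in>?Q. \<Sum>t\<in>R r. \<Sum>u\<in>?T. ?e t u)"
      unfolding energy_def by (rule split)
    \<comment> \<open>Tuples with equal sums share a class, so confining \<open>u\<close> to the
      class of \<open>t\<close> drops only zero terms.\<close>
    also have "\<dots> = (\<Sum>r\<in>?Q. \<Sum>t\<in>R r. \<Sum>u\<in>R r. ?e t u)"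
      by (rule sum.cong[OF refl], rule sum.cong[OF refl], rule sum.mono_neutral_right[OF T])
         (auto simp: R_def)
    finally show ?thesis by (simp add: sum_distrib_left)
  qed
  finally show ?thesis .
qed

section \<open>The two decoupling constants\<close>

lemma ennreal_powr_le_iff:
  assumes "r > 0" "c \<ge> 0"
  shows "ennreal_powr X r \<le> ennreal c \<longleftrightarrow> X \<le> ennreal (c powr (1 / r))"
proof (cases X)
  case (real x)
  have "x powr r \<le> c \<longleftrightarrow> x \<le> c powr (1 / r)"
  proof
    assume "x powr r \<le> c"
    then have "(x powr r) powr (1 / r) \<le> c powr (1 / r)" using assms by (intro powr_mono2) auto
    then show "x \<le> c powr (1 / r)" using assms real by (simp add: powr_powr)
  next
    assume "x \<le> c powr (1 / r)"
    then have "x powr r \<le> (c powr (1 / r)) powr r" using assms real by (intro powr_mono2) auto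
    then show "x powr r \<le> c" using assms by (simp add: powr_powr)
  qed
  then show ?thesis using real assms by (simp add: ennreal_powr_def)
qed (simp add: ennreal_powr_def top_unique)

lemma ennreal_powr_mono:
  assumes "r > 0" "X \<le> Y" shows "ennreal_powr X r \<le> ennreal_powr Y r"
proof (cases Y)
  case (real y)
  then obtain x where x: "X = ennreal x" "x \<ge> 0" using assms(2) by (cases X) (auto simp: top_unique)
  then show ?thesis using real assms by (auto simp: ennreal_powr_def intro!: ennreal_leI powr_mono2)
qed (simp add: ennreal_powr_def)

lemma ennreal_powr_half_sum_squares:
  assumes "\<And>l. l \<in> S \<Longrightarrow> b l \<ge> 0"
  shows "ennreal_powr (\<Sum>l\<in>S. (ennreal (b l))\<^sup>2) (1 / 2) = ennreal (sqrt (\<Sum>l\<in>S. (b l)\<^sup>2))"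
proof -
  have "(\<Sum>l\<in>S. (ennreal (b l))\<^sup>2) = (\<Sum>l\<in>S. ennreal ((b l)\<^sup>2))"
    using assms by (intro sum.cong refl ennreal_power)
  also have "\<dots> = ennreal (\<Sum>l\<in>S. (b l)\<^sup>2)" by (rule sum_ennreal) simp
  finally show ?thesis by (simp add: ennreal_powr_def powr_half_sqrt sum_nonneg)
qed

lemma powr_even:
  assumes "n \<ge> 1" "x \<ge> 0" shows "x powr (2 * real n) = x ^ (2 * n)"
  using assms powr_realpow[of x "2 * n"] by (cases "x = 0") auto

text \<open>Trades norms for integrals of natural powers. The norm on the left may be infinite, so
  the equivalence also serves to establish finiteness.\<close>

lemma Lp_norm_even_le_iff:
  assumes "n \<ge> 1" "c \<ge> 0"
  shows "Lp_norm (2 * real n) M f \<le> ennreal c \<longleftrightarrow>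
    (\<integral>\<^sup>+x. ennreal (norm (f x) ^ (2 * n)) \<partial>M) \<le> ennreal (c ^ (2 * n))"
  using assms by (simp add: Lp_norm_def ennreal_powr_le_iff powr_even)

text \<open>Multiplication by a positive real is invertible on \<open>ennreal\<close>, hence
  compatible with infima. Comparing best constants thus reduces to one admissible \<open>C\<close>,
  whether or not the infimum is attained.\<close>

lemma le_mult_Inf_ennreal:
  fixes K :: ennreal
  assumes "c > 0" "\<And>C. C \<in> X \<Longrightarrow> K \<le> ennreal c * C"
  shows "K \<le> ennreal c * Inf X"
proof -
  have inv: "ennreal (1 / c) * (ennreal c * C) = C" "ennreal c * (ennreal (1 / c) * C) = C" for C
    using assms(1) by (simp_all add: mult.assoc[symmetric] ennreal_mult[symmetric])
  have "ennreal (1 / c) * K \<le> Inf X"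
  proof (rule Inf_greatest)
    fix C assume "C \<in> X"
    then have "ennreal (1 / c) * K \<le> ennreal (1 / c) * (ennreal c * C)"
      by (intro mult_left_mono assms) auto
    then show "ennreal (1 / c) * K \<le> C" by (simp only: inv)
  qed
  then have "ennreal c * (ennreal (1 / c) * K) \<le> ennreal c * Inf X" by (intro mult_left_mono) auto
  then show ?thesis by (simp only: inv)
qed

text \<open>Named so that a single admissible constant can serve as a hypothesis.\<close>

definition A_admissible :: "real \<Rightarrow> int set \<Rightarrow> ennreal set" where
  "A_admissible p S = {C. \<forall>a :: int \<Rightarrow> real. (\<forall>l\<in>S. 0 \<le> a l) \<longrightarrow>
     Lp_norm p (restrict_space lborel {0..1})
         (\<lambda>x. \<Sum>l\<in>S. of_real (a l) * e (real_of_int l * x))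
       \<le> C * ennreal (sqrt (\<Sum>l\<in>S. (\<bar>a l\<bar>)\<^sup>2))}"

lemma A_admissibleD:
  assumes "C \<in> A_admissible p S" "\<And>l. l \<in> S \<Longrightarrow> 0 \<le> a l"
  shows "Lp_norm p (restrict_space lborel {0..1}) (\<lambda>x. \<Sum>l\<in>S. of_real (a l) * e (real_of_int l * x))
    \<le> C * ennreal (sqrt (\<Sum>l\<in>S. (a l)\<^sup>2))"
  using assms unfolding A_admissible_def by (simp only: mem_Collect_eq power2_abs) blast

lemma A_const_eq: "A_const p S = Inf (A_admissible p S)"
  by (simp add: A_const_def A_admissible_def)

lemma nn_integral_unit_const:
  "(\<integral>\<^sup>+x. c \<partial>restrict_space lborel {0..1::real}) = c"
  by (simp add: emeasure_restrict_space space_restrict_space)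

text \<open>Tested on a single character. In \<open>ennreal\<close> the product of 0 and \<infinity>
  is 0, so \<open>C\<close> has to be kept away from 0 for an infinite right-hand side to be
  harmless; the bound also makes the logarithm of the best constant nonnegative.\<close>

lemma A_admissible_ge_1:
  assumes S: "finite S" "S \<noteq> {}" and n: "n \<ge> 1" and C: "C \<in> A_admissible (2 * real n) S"
  shows "1 \<le> C"
proof -
  obtain l0 where l0: "l0 \<in> S" using S by auto
  define a where "a l = (if l = l0 then 1 else 0 :: real)" for l
  have "(\<Sum>l\<in>S. of_real (a l) * e (real_of_int l * x)) = e (real_of_int l0 * x)" for x
    using S l0 by (simp add: a_def if_distrib[of of_real] if_distrib[of "\<lambda>z. z * _"] cong: if_cong)
  moreover have "(\<Sum>l\<in>S. (a l)\<^sup>2) = 1"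
    using S l0 by (simp add: a_def if_distrib[of "\<lambda>z. z\<^sup>2"] cong: if_cong)
  moreover have "0 \<le> a l" for l by (simp add: a_def)
  ultimately have "Lp_norm (2 * real n) (restrict_space lborel {0..1}) (\<lambda>x. e (real_of_int l0 * x)) \<le> C"
    using A_admissibleD[OF C, of a] by simp
  moreover have "Lp_norm (2 * real n) (restrict_space lborel {0..1}) (\<lambda>x. e (real_of_int l0 * x)) = 1"
    by (simp add: Lp_norm_def ennreal_powr_def nn_integral_unit_const del: nn_integral_const)
  ultimately show ?thesis by simp
qed

lemma A_const_ge_1: "finite S \<Longrightarrow> S \<noteq> {} \<Longrightarrow> n \<ge> 1 \<Longrightarrow> 1 \<le> A_const (2 * real n) S"
  unfolding A_const_eq by (intro Inf_greatest A_admissible_ge_1)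

text \<open>Cauchy-Schwarz bounds the sum pointwise, and the unit interval has measure 1. Finiteness
  keeps the logarithms in the exponents real.\<close>

lemma A_const_finite:
  assumes S: "finite S" and n: "n \<ge> 1"
  shows "A_const (2 * real n) S < \<infinity>"
proof -
  have "ennreal (sqrt (card S)) \<in> A_admissible (2 * real n) S"
    unfolding A_admissible_def
  proof (intro CollectI allI impI)
    fix a :: "int \<Rightarrow> real" assume a: "\<forall>l\<in>S. 0 \<le> a l"
    let ?b = "sqrt (card S) * sqrt (\<Sum>l\<in>S. (\<bar>a l\<bar>)\<^sup>2)"
    have b: "norm (\<Sum>l\<in>S. of_real (a l) * e (real_of_int l * x)) \<le> ?b" for x
    proof -
      have "norm (\<Sum>l\<in>S. of_real (a l) * e (real_of_int l * x)) \<le> (\<Sum>l\<in>S. 1 * \<bar>a l\<bar>)"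
        by (rule order_trans[OF norm_sum]) (simp add: norm_mult)
      also have "\<dots> \<le> sqrt ((\<Sum>l\<in>S. 1\<^sup>2) * (\<Sum>l\<in>S. (\<bar>a l\<bar>)\<^sup>2))"
        by (rule real_le_rsqrt[OF Cauchy_Schwarz_ineq_sum])
      also have "\<dots> = sqrt (\<Sum>l\<in>S. 1\<^sup>2) * sqrt (\<Sum>l\<in>S. (\<bar>a l\<bar>)\<^sup>2)"
        by (rule real_sqrt_mult)
      finally show ?thesis by simp
    qed
    have "Lp_norm (2 * real n) (restrict_space lborel {0..1})
       (\<lambda>x. \<Sum>l\<in>S. of_real (a l) * e (real_of_int l * x)) \<le> ennreal ?b"
    proof (subst Lp_norm_even_le_iff[OF n])
      have "(\<integral>\<^sup>+x. ennreal (norm (\<Sum>l\<in>S. of_real (a l) * e (real_of_int l * x)) ^ (2 * n)) \<partial>restrict_space lborel {0..1})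
         \<le> (\<integral>\<^sup>+x. ennreal (?b ^ (2 * n)) \<partial>restrict_space lborel {0..1::real})"
        by (intro nn_integral_mono ennreal_leI power_mono b) auto
      then show "(\<integral>\<^sup>+x. ennreal (norm (\<Sum>l\<in>S. of_real (a l) * e (real_of_int l * x)) ^ (2 * n)) \<partial>restrict_space lborel {0..1})
         \<le> ennreal (?b ^ (2 * n))" by (simp only: nn_integral_unit_const)
    qed (auto intro!: mult_nonneg_nonneg sum_nonneg)
    then show "Lp_norm (2 * real n) (restrict_space lborel {0..1})
       (\<lambda>x. \<Sum>l\<in>S. of_real (a l) * e (real_of_int l * x)) \<le> ennreal (sqrt (card S)) * ennreal (sqrt (\<Sum>l\<in>S. (\<bar>a l\<bar>)\<^sup>2))"
      by (simp add: ennreal_mult sum_nonneg)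
  qed
  then have "A_const (2 * real n) S \<le> ennreal (sqrt (card S))"
    unfolding A_const_eq by (rule Inf_lower)
  then show ?thesis by (rule le_less_trans) simp
qed

section \<open>Sharp frequency cuts on a uniform grid\<close>

definition grid_interval :: "real \<Rightarrow> int \<Rightarrow> real set" where
  "grid_interval N l = {of_int l / N .. (of_int l + 1) / N}"

text \<open>Allows sums over a set of intervals, as in \<open>K_const\<close>, to be reindexed by
  integers; an interval shared by two integers would be counted only once.\<close>

lemma inj_grid_interval:
  assumes "N > 0" shows "inj_on (grid_interval N) S"
proof (rule inj_onI)
  fix k l assume "grid_interval N k = grid_interval N l"
  moreover have "of_int k / N \<le> (of_int k + 1) / N" "of_int l / N \<le> (of_int l + 1) / N"
    using assms by (auto simp: divide_right_mono)
  ultimately have "real_of_int k / N = of_int l / N"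
    unfolding grid_interval_def by (metis Icc_eq_Icc not_le)
  then show "k = l" using assms by simp
qed

lemma freq_restrict_eq_inv_fourier:
  "freq_restrict I f = inv_fourier (\<lambda>\<xi>. indicator I \<xi> * fourier f \<xi>)"
  unfolding freq_restrict_def inv_fourier_def set_lebesgue_integral_def
  by (simp add: fun_eq_iff scaleR_conv_of_real mult.assoc of_real_indicator)

lemma fourier_measurable:
  assumes "f \<in> borel_measurable borel" shows "fourier f \<in> borel_measurable borel"
proof -
  have [measurable]: "f \<in> borel_measurable borel" by fact
  show ?thesis unfolding fourier_def by measurable
qed

lemma norm_fourier_le: "norm (fourier f \<xi>) \<le> (LINT x|lborel. norm (f x))"
  unfolding fourier_def by (rule order_trans[OF integral_norm_bound]) (simp add: norm_mult)

text \<open>\<open>fourier f\<close> is bounded, so its cut-off to a bounded interval is an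
  integrable density even though the resulting piece need not be integrable.\<close>

lemma band_freq_restrict:
  assumes "f \<in> borel_measurable borel" shows "band a b (freq_restrict {a..b} f)"
proof -
  have [measurable]: "fourier f \<in> borel_measurable borel" by (rule fourier_measurable[OF assms])
  have "integrable lborel (\<lambda>\<xi>. indicator {a..b} \<xi> * fourier f \<xi>)"
  proof (rule Bochner_Integration.integrable_bound)
    show "integrable lborel (\<lambda>\<xi>. indicator {a..b} \<xi> * (LINT x|lborel. norm (f x)))"
      by (intro integrable_mult_left integrable_real_indicator) (auto simp: emeasure_lborel_Icc_eq)
    show "AE \<xi> in lborel. norm (indicator {a..b} \<xi> * fourier f \<xi>)
        \<le> norm (indicator {a..b} \<xi> * (LINT x|lborel. norm (f x)))"
      using norm_fourier_le[of f] by (intro AE_I2) (auto simp: norm_mult split: split_indicator)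
  qed measurable
  then show ?thesis
    unfolding band_def freq_restrict_eq_inv_fourier
    by (intro exI[of _ "\<lambda>\<xi>. indicator {a..b} \<xi> * fourier f \<xi>"]) (auto split: split_indicator_asm)
qed

lemma schwartz_measurable:
  assumes "schwartz f" shows "f \<in> borel_measurable borel"
proof -
  obtain F where F: "F 0 = f" "\<And>m x. (F m has_vector_derivative F (Suc m) x) (at x)"
    using assms unfolding schwartz_def by blast
  have "continuous_on UNIV (F 0)"
    using F(2)[of 0] by (intro continuous_at_imp_continuous_on) (auto intro: has_vector_derivative_continuous)
  then show ?thesis using F(1) by (auto intro: borel_measurable_continuous_onI)
qed

lemma Suc_le_four_power: "real n + 1 \<le> 2 ^ (2 * n)"
proof -
  have "n + 1 \<le> 4 ^ n" by (induction n) auto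
  then have "real (n + 1) \<le> real (4 ^ n)" by (rule of_nat_mono)
  then show ?thesis by (simp add: power_mult)
qed

theorem K_const_le_A_const:
  assumes S: "finite S" "S \<noteq> {}" and n: "n \<ge> 1" and N: "N > 0"
  shows "K_const (2 * real n) (grid_interval N ` S) \<le> ennreal 2 * A_const (2 * real n) S"
  unfolding A_const_eq
proof (rule le_mult_Inf_ennreal)
  fix C assume C: "C \<in> A_admissible (2 * real n) S"
  note C1 = A_admissible_ge_1[OF S n C]
  show "K_const (2 * real n) (grid_interval N ` S) \<le> ennreal 2 * C"
  proof (cases C)
    case (real c)
    with C1 have c1: "c \<ge> 1" by simp
    have "Lp_norm (2 * real n) lborel (\<lambda>x. \<Sum>I\<in>grid_interval N ` S. freq_restrict I f x) \<le>
       ennreal 2 * C * ennreal_powr (\<Sum>I\<in>grid_interval N ` S. (Lp_norm (2 * real n) lborel (freq_restrict I f))\<^sup>2) (1 / 2)"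
      if f: "schwartz f" for f
    proof -
      let ?f = "\<lambda>l. freq_restrict (grid_interval N l) f"
      let ?L = "\<lambda>l. Lp_norm (2 * real n) lborel (?f l)"
      let ?X = "Lp_norm (2 * real n) lborel (\<lambda>x. \<Sum>l\<in>S. ?f l x)"
      have band: "band (of_int l / N) ((of_int l + 1) / N) (?f l)" for l
        unfolding grid_interval_def by (rule band_freq_restrict[OF schwartz_measurable[OF f]])
      have "?X \<le> ennreal 2 * C * ennreal_powr (\<Sum>l\<in>S. (?L l)\<^sup>2) (1 / 2)"
      \<comment> \<open>A piece of infinite norm makes the right-hand side infinite, because
        \<open>C\<close> is at least 1. Otherwise all norms are real numbers
        \<open>b l\<close>.\<close>
      proof (cases "\<exists>l\<in>S. ?L l = \<infinity>")
        case True
        then obtain l where l: "l \<in> S" "?L l = \<infinity>" by blast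
        then have "(?L l)\<^sup>2 = \<infinity>" by (simp add: power2_eq_square ennreal_top_mult)
        then have "(\<Sum>l\<in>S. (?L l)\<^sup>2) = \<infinity>"
          using member_le_sum[of l S "\<lambda>l. (?L l)\<^sup>2"] S(1) l(1) by (simp add: top_unique)
        then show ?thesis using c1 real
          by (simp add: ennreal_powr_def ennreal_mult_top ennreal_mult[symmetric] ennreal_mult_eq_top_iff)
      next
        case False
        define b where "b l = enn2real (?L l)" for l
        have b: "?L l = ennreal (b l)" if "l \<in> S" for l
          using False that unfolding b_def by (cases "?L l") auto
        have b0: "b l \<ge> 0" for l by (simp add: b_def)
        \<comment> \<open>Each norm is enlarged by \<eta> > 0, since \<open>even_decoupling\<close>
          asks for positive majorants and some \<open>b l\<close> may be 0. The bound
          \<open>g\<close> is continuous at 0.\<close>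
        define g where "g \<eta> = 2 * c * sqrt (\<Sum>l\<in>S. (b l + \<eta>)\<^sup>2)" for \<eta>
        have X: "?X \<le> ennreal (g \<eta>)" if \<eta>: "\<eta> > 0" for \<eta>
        proof -
          let ?s = "sqrt (\<Sum>l\<in>S. (b l + \<eta>)\<^sup>2)"
          have s0: "?s \<ge> 0" by (simp add: sum_nonneg)
          have "Lp_norm (2 * real n) (restrict_space lborel {0..1})
              (\<lambda>x. \<Sum>l\<in>S. of_real (b l + \<eta>) * e (real_of_int l * x)) \<le> ennreal (c * ?s)"
          proof -
            have "0 \<le> b l + \<eta>" for l using b0[of l] \<eta> by linarith
            from A_admissibleD[OF C this] show ?thesis
              using real s0 by (simp only: ennreal_mult)
          qed
          then have "ennreal (energy S n (\<lambda>l. b l + \<eta>)) \<le> ennreal ((c * ?s) ^ (2 * n))"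
            using c1 s0 by (subst (asm) Lp_norm_even_le_iff[OF n]) (auto simp only: trig_moment[OF S(1)] intro!: mult_nonneg_nonneg)
          then have en: "energy S n (\<lambda>l. b l + \<eta>) \<le> (c * ?s) ^ (2 * n)"
            using c1 s0 by (subst (asm) ennreal_le_iff) auto
          have "(\<integral>\<^sup>+x. ennreal (norm (\<Sum>l\<in>S. ?f l x) ^ (2 * n)) \<partial>lborel)
             \<le> ennreal ((real n + 1) * energy S n (\<lambda>l. b l + \<eta>))"
          proof (rule even_decoupling[OF S(1) n N band])
            fix l assume l: "l \<in> S"
            show "b l + \<eta> > 0" using b0[of l] \<eta> by linarith
            have "?L l \<le> ennreal (b l + \<eta>)" using b[OF l] \<eta> by (simp add: ennreal_leI)
            then show "(\<integral>\<^sup>+x. ennreal (norm (?f l x) ^ (2 * n)) \<partial>lborel) \<le> ennreal ((b l + \<eta>) ^ (2 * n))"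
              using b0[of l] \<eta> by (subst (asm) Lp_norm_even_le_iff[OF n]) auto
          qed
          also have "\<dots> \<le> ennreal (2 ^ (2 * n) * (c * ?s) ^ (2 * n))"
          proof (rule ennreal_leI)
            have "(real n + 1) * energy S n (\<lambda>l. b l + \<eta>) \<le> (real n + 1) * (c * ?s) ^ (2 * n)"
              using en by (rule mult_left_mono) simp
            also have "\<dots> \<le> 2 ^ (2 * n) * (c * ?s) ^ (2 * n)"
              using c1 s0 Suc_le_four_power by (intro mult_right_mono) auto
            finally show "(real n + 1) * energy S n (\<lambda>l. b l + \<eta>) \<le> 2 ^ (2 * n) * (c * ?s) ^ (2 * n)" .
          qed
          also have "\<dots> = ennreal (g \<eta> ^ (2 * n))"
            by (simp only: g_def power_mult_distrib[symmetric] mult.assoc)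
          finally show ?thesis
            using c1 s0 by (subst Lp_norm_even_le_iff[OF n]) (auto simp: g_def)
        qed
        have "(\<lambda>m. g (1 / real (Suc m))) \<longlonglongrightarrow> g 0"
        proof -
          have "(\<lambda>m. 1 / real (Suc m)) \<longlonglongrightarrow> 0"
            using LIMSEQ_inverse_real_of_nat by (simp add: inverse_eq_divide)
          then show ?thesis unfolding g_def by (intro tendsto_intros)
        qed
        then have "?X \<le> ennreal (g 0)"
          by (intro LIMSEQ_le_const[OF tendsto_ennrealI]) (auto intro!: X)
        also have "\<dots> = ennreal 2 * C * ennreal_powr (\<Sum>l\<in>S. (?L l)\<^sup>2) (1 / 2)"
          using c1 real b b0 by (simp add: g_def ennreal_powr_half_sum_squares ennreal_mult sum_nonneg)
        finally show ?thesis .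
      qed
      then show ?thesis by (simp add: sum.reindex[OF inj_grid_interval[OF N]])
    qed
    then show ?thesis unfolding K_const_def by (intro Inf_lower) blast
  qed (simp add: ennreal_mult_top)
qed simp

section \<open>Gaussian test functions\<close>

text \<open>The term of order \<open>r\<close> in the exponential series at pi s^2 x^2 controls
  x^(2r), and |x|^r \<le> 1 + x^(2r) reduces every power to an even one.\<close>

lemma power_mult_gauss_bounded:
  assumes "s > 0" shows "bounded (range (\<lambda>x. \<bar>x\<bar> ^ r * gauss s x))"
proof -
  define c where "c = pi * s\<^sup>2"
  have c: "c > 0" using assms by (simp add: c_def)
  have "\<bar>x\<bar> ^ r * gauss s x \<le> 1 + fact r / c ^ r" for x
  proof -
    have 1: "(x\<^sup>2) ^ r * gauss s x \<le> fact r / c ^ r"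
    proof -
      have "(c * x\<^sup>2) ^ r / fact r \<le> exp (c * x\<^sup>2)"
      proof -
        have "(\<Sum>k\<in>{r}. (c * x\<^sup>2) ^ k /\<^sub>R fact k) \<le> (\<Sum>k. (c * x\<^sup>2) ^ k /\<^sub>R fact k)"
          using c by (intro sum_le_suminf summable_exp_generic) auto
        then show ?thesis by (simp add: exp_def divide_inverse mult.commute)
      qed
      then have "(c * x\<^sup>2) ^ r / fact r / exp (c * x\<^sup>2) \<le> 1" by (simp only: divide_le_eq_1_pos exp_gt_zero)
      then have "(c * x\<^sup>2) ^ r / fact r / exp (c * x\<^sup>2) * (fact r / c ^ r) \<le> 1 * (fact r / c ^ r)"
        using c by (intro mult_right_mono) auto
      moreover have "gauss s x = 1 / exp (c * x\<^sup>2)"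
        by (simp add: gauss_def c_def power_mult_distrib exp_minus field_simps)
      ultimately show ?thesis using c by (simp add: power_mult_distrib)
    qed
    have "\<bar>x\<bar> ^ r \<le> 1 + (x\<^sup>2) ^ r"
    proof (cases "\<bar>x\<bar> \<le> 1")
      case True
      then have "\<bar>x\<bar> ^ r \<le> 1" by (simp add: power_le_one)
      then show ?thesis by (simp add: add_increasing2)
    next
      case False
      then have "\<bar>x\<bar> ^ r \<le> \<bar>x\<bar> ^ (2 * r)" by (intro power_increasing) auto
      then show ?thesis by (simp add: power_mult)
    qed
    then have "\<bar>x\<bar> ^ r * gauss s x \<le> (1 + (x\<^sup>2) ^ r) * gauss s x"
      using gauss_pos[of s x] by (intro mult_right_mono) auto
    also have "\<dots> \<le> 1 + fact r / c ^ r"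
      using 1 gauss_le_1[of s x] by (simp add: distrib_right)
    finally show ?thesis .
  qed
  then show ?thesis
    using gauss_pos[of s] by (intro boundedI[of _ "1 + fact r / c ^ r"]) (auto simp: abs_mult less_imp_le)
qed

text \<open>Induction on the coefficients; \<open>r\<close> is left free to absorb the factor x that
  \<open>pCons\<close> splits off.\<close>

lemma poly_mult_gauss_bounded:
  fixes Q :: "complex poly"
  assumes "s > 0"
  shows "bounded (range (\<lambda>x. of_real (x ^ r * gauss s x) * poly Q (of_real x)))"
proof (induction Q arbitrary: r)
  case 0
  then show ?case by simp
next
  case (pCons a Q)
  have "bounded (range (\<lambda>x. complex_of_real (x ^ r * gauss s x) * a))"
  proof -
    obtain B where B: "\<And>x. \<bar>x\<bar> ^ r * gauss s x \<le> B"
      using power_mult_gauss_bounded[OF assms, of r] unfolding bounded_iff by (auto intro: order_trans[OF abs_ge_self])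
    have "norm (complex_of_real (x ^ r * gauss s x) * a) \<le> B * norm a" for x
      using mult_right_mono[OF B[of x], of "norm a"] gauss_pos[of s x]
      by (simp add: norm_mult norm_power abs_mult power_abs)
    then show ?thesis by (intro boundedI[of _ "B * norm a"]) auto
  qed
  from bounded_plus_comp[OF this pCons(2)[of "Suc r"]]
  show ?case by (simp add: algebra_simps image_image)
qed

text \<open>Every derivative is a polynomial times the same exponential. The recursion for
  \<open>Q\<close> is the product rule, the linear factor being the derivative of the exponent; it
  is carried out in a complex variable and restricted to the line.\<close>

lemma schwartz_modulated_gauss:
  assumes "s > 0" shows "schwartz (\<lambda>x. e (b * x) * of_real (gauss s x))"
proof -
  define Q :: "nat \<Rightarrow> complex poly" where
    "Q m = ((\<lambda>P. pderiv P + [:2 * of_real pi * \<i> * of_real b, - of_real (2 * pi * s\<^sup>2):] * P) ^^ m) 1" for m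
  have Q: "Q 0 = 1" "Q (Suc m) = pderiv (Q m) + [:2 * of_real pi * \<i> * of_real b, - of_real (2 * pi * s\<^sup>2):] * Q m" for m
    by (simp_all add: Q_def)
  define F where "F m x = poly (Q m) (of_real x) * (e (b * x) * of_real (gauss s x))" for m x
  have "(F m has_vector_derivative F (Suc m) x) (at x)" for m x
  proof -
    have e: "e (b * x) * of_real (gauss s x) = exp (2 * of_real pi * \<i> * of_real b * of_real x - of_real (pi * s\<^sup>2) * of_real x ^ 2)" for x
      by (simp add: e_def gauss_def exp_of_real[symmetric] exp_add[symmetric] power_mult_distrib mult_ac)
    define H where "H z = poly (Q m) z * exp (2 * of_real pi * \<i> * of_real b * z - of_real (pi * s\<^sup>2) * z ^ 2)" for z
    have "(H has_field_derivative poly (Q (Suc m)) z * exp (2 * of_real pi * \<i> * of_real b * z - of_real (pi * s\<^sup>2) * z ^ 2)) (at z)" for z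
      unfolding H_def Q
      by (rule derivative_eq_intros refl poly_DERIV)+ (simp add: algebra_simps)
    then have "((\<lambda>x. H (of_real x)) has_vector_derivative
        poly (Q (Suc m)) (of_real x) * exp (2 * of_real pi * \<i> * of_real b * of_real x - of_real (pi * s\<^sup>2) * of_real x ^ 2)) (at x)"
      by (rule has_vector_derivative_real_field)
    then show ?thesis unfolding F_def H_def e by simp
  qed
  moreover have "bounded (range (\<lambda>x. x ^ r *\<^sub>R F m x))" for m r
  proof -
    obtain B where B: "\<And>x. norm (complex_of_real (x ^ r * gauss s x) * poly (Q m) (of_real x)) \<le> B"
      using poly_mult_gauss_bounded[OF assms, of r "Q m"] unfolding bounded_iff by auto
    have "norm (x ^ r *\<^sub>R F m x) = norm (complex_of_real (x ^ r * gauss s x) * poly (Q m) (of_real x))" for x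
      by (simp add: F_def norm_mult norm_power abs_mult power_abs mult_ac)
    with B have "norm (x ^ r *\<^sub>R F m x) \<le> B" for x by simp
    then show ?thesis by (intro boundedI[of _ B]) auto
  qed
  moreover have "F 0 = (\<lambda>x. e (b * x) * of_real (gauss s x))"
    by (simp add: F_def Q fun_eq_iff)
  ultimately show ?thesis unfolding schwartz_def by blast
qed

lemma schwartz_0: "schwartz (\<lambda>x. 0)"
  unfolding schwartz_def by (intro exI[of _ "\<lambda>m x. 0"]) auto

lemma schwartz_cmult_add:
  assumes "schwartz f" "schwartz g" shows "schwartz (\<lambda>x. c * f x + g x)"
proof -
  obtain F where F: "F 0 = f" "\<And>m x. (F m has_vector_derivative F (Suc m) x) (at x)"
      "\<And>m r. bounded (range (\<lambda>x. x ^ r *\<^sub>R F m x))"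
    using assms(1) unfolding schwartz_def by blast
  obtain G where G: "G 0 = g" "\<And>m x. (G m has_vector_derivative G (Suc m) x) (at x)"
      "\<And>m r. bounded (range (\<lambda>x. x ^ r *\<^sub>R G m x))"
    using assms(2) unfolding schwartz_def by blast
  have "bounded (range (\<lambda>x. x ^ r *\<^sub>R (c * F m x + G m x)))" for m r
  proof -
    have "bounded (range (\<lambda>x. c * (x ^ r *\<^sub>R F m x)))"
      using bounded_linear_image[OF F(3)[of r m] bounded_linear_mult_right[of c]] by (simp add: image_image)
    from bounded_plus_comp[OF this G(3)[of r m]] show ?thesis
      by (simp add: scaleR_add_right)
  qed
  then show ?thesis
    unfolding schwartz_def using F(1,2) G(1,2)
    by (intro exI[of _ "\<lambda>m x. c * F m x + G m x"]) (auto intro!: derivative_eq_intros simp: F(1) G(1))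
qed

lemma schwartz_sum:
  assumes "finite S" "\<And>l. l \<in> S \<Longrightarrow> schwartz (f l)"
  shows "schwartz (\<lambda>x. \<Sum>l\<in>S. c l * f l x)"
  using assms by (induction S rule: finite_induct) (auto simp: schwartz_0 intro!: schwartz_cmult_add)

lemma gauss_sym: "gauss s (x - y) = gauss s (y - x)"
  by (simp add: gauss_def power_mult_distrib power2_commute)

text \<open>A Gaussian of mass 1 centred at \<open>b\<close> is an explicit density for the Gaussian
  modulated to frequency \<open>b\<close>; this takes the place of Fourier inversion for the test
  functions.\<close>

lemma gauss_shift:
  assumes "s > 0"
  shows "integrable lborel (\<lambda>\<xi>. gauss (1 / s) (\<xi> - b) / s)"
    and "(LINT \<xi>|lborel. gauss (1 / s) (\<xi> - b) / s) = 1"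
    and "inv_fourier (\<lambda>\<xi>. of_real (gauss (1 / s) (\<xi> - b) / s)) x = e (b * x) * of_real (gauss s x)"
proof -
  have [simp]: "-b + 1 * \<xi> = \<xi> - b" for \<xi> by simp
  show "integrable lborel (\<lambda>\<xi>. gauss (1 / s) (\<xi> - b) / s)"
    using lborel_integrable_real_affine[OF gauss_integrable[of "1 / s"], of 1 "-b"] assms by simp
  show "(LINT \<xi>|lborel. gauss (1 / s) (\<xi> - b) / s) = 1"
    using lborel_integral_real_affine[of 1 "gauss (1 / s)" "-b"] gauss_integral[of "1 / s"] assms by simp
  have "inv_fourier (\<lambda>\<xi>. of_real (gauss (1 / s) (\<xi> - b) / s)) x =
     (LINT \<xi>|lborel. of_real (gauss (1 / s) (b + 1 * \<xi> - b) / s) * e (x * (b + 1 * \<xi>)))"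
    unfolding inv_fourier_def by (subst lborel_integral_real_affine[where c=1 and t=b]) auto
  also have "\<dots> = (LINT \<xi>|lborel. e (b * x) / of_real s * (of_real (gauss (1 / s) \<xi>) * e (\<xi> * x)))"
    by (intro Bochner_Integration.integral_cong) (auto simp: e_add algebra_simps)
  also have "\<dots> = e (b * x) / of_real s * of_real (gauss s x * s)"
    using gauss_fourier[of "1 / s" x] assms by simp
  finally show "inv_fourier (\<lambda>\<xi>. of_real (gauss (1 / s) (\<xi> - b) / s)) x = e (b * x) * of_real (gauss s x)"
    using assms by simp
qed

lemma fourier_modulated_gauss_sum:
  assumes "s > 0"
  shows "fourier (\<lambda>x. \<Sum>l\<in>S. of_real (a l) * (e (b l * x) * of_real (gauss s x))) \<xi> =
     of_real (\<Sum>l\<in>S. a l * (gauss (1 / s) (\<xi> - b l) / s))"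
proof -
  have "fourier (\<lambda>x. \<Sum>l\<in>S. of_real (a l) * (e (b l * x) * of_real (gauss s x))) \<xi> =
     (LINT x|lborel. (\<Sum>l\<in>S. of_real (a l) * (of_real (gauss s x) * e (x * (b l - \<xi>)))))"
    unfolding fourier_def
  proof (intro Bochner_Integration.integral_cong refl)
    fix x
    have "e (x * (b l - \<xi>)) = e (b l * x) * e (- (x * \<xi>))" for l
      by (simp only: e_add[symmetric]) (simp add: algebra_simps)
    then show "(\<Sum>l\<in>S. of_real (a l) * (e (b l * x) * of_real (gauss s x))) * e (- (x * \<xi>)) =
      (\<Sum>l\<in>S. of_real (a l) * (of_real (gauss s x) * e (x * (b l - \<xi>))))"
      unfolding sum_distrib_right by (intro sum.cong refl) (simp add: mult_ac)
  qed
  also have "\<dots> = (\<Sum>l\<in>S. of_real (a l) * (LINT x|lborel. of_real (gauss s x) * e (x * (b l - \<xi>))))"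
    using gauss_mult_e_integrable[of s] assms by (subst Bochner_Integration.integral_sum) auto
  also have "\<dots> = of_real (\<Sum>l\<in>S. a l * (gauss (1 / s) (b l - \<xi>) / s))"
    unfolding gauss_fourier[OF assms] by simp
  finally show ?thesis by (simp add: gauss_sym)
qed

section \<open>Periodic integrals and p-th powers of sums\<close>

lemma nn_integral_periodic:
  fixes g :: "real \<Rightarrow> ennreal"
  assumes [measurable]: "g \<in> borel_measurable borel" and per: "\<And>x. g (x + 1) = g x"
  shows "(\<integral>\<^sup>+x\<in>{0..<real M}. g x \<partial>lborel) = of_nat M * (\<integral>\<^sup>+x. g x \<partial>restrict_space lborel {0..1})"
proof (induction M)
  case (Suc M)
  have pm: "g (x + real m) = g x" for x m
  proof (induction m)
    case (Suc m)
    then show ?case using per[of "x + real m"] by (simp add: add_ac)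
  qed simp
  have "(\<integral>\<^sup>+x\<in>{0..<real (Suc M)}. g x \<partial>lborel) =
     (\<integral>\<^sup>+x. g x * indicator {0..<real M} x + g x * indicator {real M..<real M + 1} x \<partial>lborel)"
    by (intro nn_integral_cong) (auto split: split_indicator)
  also have "\<dots> = (\<integral>\<^sup>+x\<in>{0..<real M}. g x \<partial>lborel) + (\<integral>\<^sup>+x\<in>{real M..<real M + 1}. g x \<partial>lborel)"
    by (rule nn_integral_add) auto
  also have "(\<integral>\<^sup>+x\<in>{real M..<real M + 1}. g x \<partial>lborel) =
     (\<integral>\<^sup>+x. g (real M + 1 * x) * indicator {real M..<real M + 1} (real M + 1 * x) \<partial>lborel)"
    by (subst nn_integral_real_affine[where c=1 and t="real M"]) auto
  also have "\<dots> = (\<integral>\<^sup>+x. g x * indicator {0..1} x \<partial>lborel)"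
    \<comment> \<open>Half-open periods tile the range disjointly, whereas the norm in
      \<open>A_const\<close> lives on the closed interval; the difference is a null set.\<close>
    using AE_lborel_singleton[of 1]
    by (intro nn_integral_cong_AE) (auto elim!: eventually_mono simp: pm add.commute[of "real M"] split: split_indicator)
  also have "\<dots> = (\<integral>\<^sup>+x. g x \<partial>restrict_space lborel {0..1})"
    by (subst nn_integral_restrict_space) auto
  finally show ?case using Suc by (simp add: distrib_right add.commute)
qed simp

lemma norm_add_power_le:
  fixes u v :: complex
  shows "norm (u + v) ^ p \<le> 2 ^ p * (norm u ^ p + norm v ^ p)"
proof -
  have "norm (u + v) ^ p \<le> (2 * max (norm u) (norm v)) ^ p"
    by (intro power_mono order_trans[OF norm_triangle_ineq]) auto
  also have "\<dots> \<le> 2 ^ p * (norm u ^ p + norm v ^ p)"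
    by (auto simp: power_mult_distrib max_def)
  finally show ?thesis .
qed

lemma nn_integral_norm_add_power_le:
  fixes u v :: "real \<Rightarrow> complex"
  assumes [measurable]: "u \<in> borel_measurable borel" "v \<in> borel_measurable borel"
  shows "(\<integral>\<^sup>+x. ennreal (norm (u x + v x) ^ p) \<partial>lborel) \<le>
     ennreal (2 ^ p) * ((\<integral>\<^sup>+x. ennreal (norm (u x) ^ p) \<partial>lborel) + (\<integral>\<^sup>+x. ennreal (norm (v x) ^ p) \<partial>lborel))"
proof -
  have "(\<integral>\<^sup>+x. ennreal (norm (u x + v x) ^ p) \<partial>lborel) \<le>
    (\<integral>\<^sup>+x. ennreal (2 ^ p) * (ennreal (norm (u x) ^ p) + ennreal (norm (v x) ^ p)) \<partial>lborel)"
    by (intro nn_integral_mono)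
       (simp only: ennreal_plus[symmetric] ennreal_mult[symmetric] zero_le_power norm_ge_zero add_nonneg_nonneg
         zero_le_numeral ennreal_leI norm_add_power_le)
  also have "\<dots> = ennreal (2 ^ p) * ((\<integral>\<^sup>+x. ennreal (norm (u x) ^ p) \<partial>lborel) + (\<integral>\<^sup>+x. ennreal (norm (v x) ^ p) \<partial>lborel))"
    by (simp add: nn_integral_cmult nn_integral_add)
  finally show ?thesis .
qed

lemma gauss_power: "gauss s x ^ p = gauss (s * sqrt p) x"
  by (simp add: gauss_def exp_of_nat_mult[symmetric] power_mult_distrib mult_ac)

text \<open>Merges the bounds for a main part and its error into one p-th power, so that the p-th
  root produces \<open>a l + \<eta>\<close>.\<close>

lemma add_power_le:
  fixes x y :: real
  assumes "x \<ge> 0" "y \<ge> 0" "p \<ge> 1"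
  shows "x ^ p + y ^ p \<le> (x + y) ^ p"
  using assms(3)
proof (induction p rule: nat_induct_at_least)
  case (Suc p)
  have "x ^ Suc p + y ^ Suc p \<le> (x + y) * (x ^ p + y ^ p)"
    using assms by (simp add: algebra_simps)
  also have "\<dots> \<le> (x + y) * (x + y) ^ p"
    using Suc assms by (intro mult_left_mono) auto
  finally show ?case by simp
qed simp

text \<open>The width \<open>\<epsilon>\<close> below is chosen so that \<open>gauss \<epsilon> ^ (2 * n)\<close> has total mass \<open>w = M N\<close> and is at
  least \<open>exp (- pi)\<close> on \<open>[0, M N]\<close>, that is on \<open>M\<close> periods. The function \<open>G l\<close> is the frequency
  error of the \<open>l\<close>-th piece, absorbed by \<open>\<eta>\<close>; in place of Minkowski's inequality, $|u + v|^p \le 2^p (|u|^p + |v|^p)$ costs only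
  an absolute constant after taking \<open>p\<close>-th roots.\<close>

lemma energy_le_gaussian_test:
  fixes S :: "int set" and a :: "int \<Rightarrow> real" and \<kappa> :: real
  assumes S: "finite S" "S \<noteq> {}" and n: "n \<ge> 1" and N: "N > 0" and \<kappa>: "\<kappa> \<ge> 0"
    and a: "\<And>l. l \<in> S \<Longrightarrow> 0 \<le> a l"
    and adm: "\<And>f. schwartz f \<Longrightarrow> Lp_norm (2 * real n) lborel (\<lambda>x. \<Sum>l\<in>S. freq_restrict (grid_interval N l) f x)
       \<le> ennreal \<kappa> * ennreal_powr (\<Sum>l\<in>S. (Lp_norm (2 * real n) lborel (freq_restrict (grid_interval N l) f))\<^sup>2) (1 / 2)"
    and \<eta>: "\<eta> > 0"
  shows "exp (- pi) * energy S n a \<le> 2 ^ (2 * n) * ((2 * \<kappa> * sqrt (\<Sum>l\<in>S. (a l + \<eta>)\<^sup>2)) ^ (2 * n) + \<eta> ^ (2 * n))"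
proof -
  let ?p = "2 * n"
  define s where "s = (\<Sum>l\<in>S. a l)"
  define m where "m = real (card S)"
  have s0: "s \<ge> 0" using a by (auto simp: s_def intro: sum_nonneg)
  have m1: "m \<ge> 1" using S by (simp add: m_def Suc_le_eq card_gt_0_iff)
  \<comment> \<open>The leakage \<delta> below is at most 4 N while the mass is w = M N, so this
    many periods give (m s)^p \<delta> \<le> \<eta>^p w for p = 2n. The summand 1 secures M \<ge>
    1.\<close>
  obtain M :: nat where "4 * (m * s) ^ ?p / \<eta> ^ ?p + 1 \<le> real M"
    using real_arch_simple by blast
  moreover have "0 \<le> 4 * (m * s) ^ ?p / \<eta> ^ ?p" using \<eta> by (auto intro!: divide_nonneg_nonneg)
  ultimately have M1: "real M \<ge> 1" and M: "4 * (m * s) ^ ?p / \<eta> ^ ?p \<le> real M" by linarith+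
  define \<epsilon> where "\<epsilon> = 1 / (real M * N * sqrt ?p)"
  have \<epsilon>: "\<epsilon> > 0" using M1 N n by (simp add: \<epsilon>_def)
  define w where "w = real M * N"
  have w: "w > 0" using M1 N by (simp add: w_def)
  \<comment> \<open>The height of a spectral bump half a cell away from its centre; it bounds
    pointwise whatever a bump places outside its own interval.\<close>
  define \<delta> where "\<delta> = gauss (1 / \<epsilon>) (1 / (2 * N)) / \<epsilon>"
  have \<delta>0: "\<delta> \<ge> 0" using \<epsilon> by (simp add: \<delta>_def gauss_pos less_imp_le)
  have \<delta>: "(m * s) ^ ?p * \<delta> \<le> \<eta> ^ ?p * w"
  proof -
    have "\<delta> \<le> \<epsilon> / (pi * (1 / (2 * N))\<^sup>2)"
      unfolding \<delta>_def by (rule gauss_tail) (use \<epsilon> N in auto)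
    also have "\<dots> = 4 * N / (pi * real M * sqrt ?p)"
      using N M1 by (simp add: \<epsilon>_def field_simps power2_eq_square)
    also have "\<dots> \<le> 4 * N / 1"
    proof (rule divide_left_mono)
      have "1 * 1 * 1 \<le> pi * real M * sqrt ?p"
        using pi_gt3 M1 n by (intro mult_mono) auto
      then show "1 \<le> pi * real M * sqrt ?p" by simp
      then show "0 < pi * real M * sqrt ?p * 1" by linarith
    qed (use N in auto)
    finally have "(m * s) ^ ?p * \<delta> \<le> (m * s) ^ ?p * (4 * N)"
      using m1 s0 by (intro mult_left_mono) auto
    also have "\<dots> \<le> \<eta> ^ ?p * w"
      using M \<eta> N by (simp add: w_def field_simps)
    finally show ?thesis .
  qed
  have s\<delta>: "s ^ ?p * \<delta> \<le> \<eta> ^ ?p * w"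
  proof (rule order_trans[OF _ \<delta>])
    have "1 * s \<le> m * s" using m1 s0 by (rule mult_right_mono)
    then show "s ^ ?p * \<delta> \<le> (m * s) ^ ?p * \<delta>"
      using s0 \<delta>0 by (intro mult_right_mono power_mono) auto
  qed
  \<comment> \<open>Midpoints keep the bumps as far as possible from the ends of their
    intervals.\<close>
  define b where "b l = (of_int l + 1 / 2) / N" for l :: int
  define k where "k l \<xi> = gauss (1 / \<epsilon>) (\<xi> - b l) / \<epsilon>" for l \<xi>
  have k0: "k l \<xi> \<ge> 0" for l \<xi> using \<epsilon> by (simp add: k_def gauss_pos less_imp_le)
  have kint: "integrable lborel (k l)" for l unfolding k_def by (rule gauss_shift[OF \<epsilon>])
  have k1: "(LINT \<xi>|lborel. k l \<xi>) = 1" for l unfolding k_def by (rule gauss_shift[OF \<epsilon>])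
  have [measurable]: "k l \<in> borel_measurable borel" for l using kint[of l] by auto
  have invk: "inv_fourier (\<lambda>\<xi>. of_real (k l \<xi>)) x = e (b l * x) * of_real (gauss \<epsilon> x)" for l x
    unfolding k_def by (rule gauss_shift[OF \<epsilon>])
  have ktail: "k l \<xi> \<le> \<delta>" if "1 / (2 * N) \<le> \<bar>\<xi> - b l\<bar>" for l \<xi>
    unfolding k_def \<delta>_def using that \<epsilon> N by (intro divide_right_mono gauss_antimono) auto
  have mid: "of_int l / N = b l - 1 / (2 * N)" "(of_int l + 1) / N = b l + 1 / (2 * N)" for l
    using N by (auto simp: b_def field_simps)
  have bdist: "1 / N \<le> \<bar>b l - b l'\<bar>" if "l \<noteq> l'" for l l'
  proof -
    have "b l - b l' = of_int (l - l') / N" by (simp add: b_def diff_divide_distrib[symmetric])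
    moreover have "1 \<le> \<bar>real_of_int (l - l')\<bar>" using that by linarith
    ultimately show ?thesis using N by (simp add: abs_div divide_right_mono)
  qed
  define f where "f x = (\<Sum>l\<in>S. of_real (a l) * (e (b l * x) * of_real (gauss \<epsilon> x)))" for x
  have f: "schwartz f"
    unfolding f_def by (intro schwartz_sum schwartz_modulated_gauss S \<epsilon>)
  have ff: "fourier f \<xi> = of_real (\<Sum>l\<in>S. a l * k l \<xi>)" for \<xi>
    unfolding f_def k_def by (rule fourier_modulated_gauss_sum[OF \<epsilon>])
  \<comment> \<open>The cut spectrum minus its own bump: on the interval this is the leakage of the
    other bumps, off the interval minus the tail of the own bump. It is uniformly small
    (\<open>Gle\<close>), while its mass is merely bounded (\<open>Gle2\<close>), which is what
    \<open>inv_fourier_Lp\<close> asks for.\<close>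
  define G where "G l \<xi> = indicator (grid_interval N l) \<xi> * (\<Sum>l'\<in>S. a l' * k l' \<xi>) - a l * k l \<xi>" for l \<xi>
  have Gle: "\<bar>G l \<xi>\<bar> \<le> s * \<delta>" and Gle2: "\<bar>G l \<xi>\<bar> \<le> (\<Sum>l'\<in>S. a l' * k l' \<xi>)" if l: "l \<in> S" for l \<xi>
  proof -
    have sp: "(\<Sum>l'\<in>S. a l' * k l' \<xi>) = a l * k l \<xi> + (\<Sum>l'\<in>S - {l}. a l' * k l' \<xi>)"
      by (rule sum.remove[OF S(1) l])
    have nn: "0 \<le> a l * k l \<xi>" "0 \<le> (\<Sum>l'\<in>S - {l}. a l' * k l' \<xi>)"
      using a l k0 by (auto intro!: sum_nonneg)
    then show "\<bar>G l \<xi>\<bar> \<le> (\<Sum>l'\<in>S. a l' * k l' \<xi>)"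
      unfolding G_def sp by (auto split: split_indicator)
    show "\<bar>G l \<xi>\<bar> \<le> s * \<delta>"
    proof (cases "\<xi> \<in> grid_interval N l")
      case True
      then have \<xi>: "\<bar>\<xi> - b l\<bar> \<le> 1 / (2 * N)" by (auto simp: grid_interval_def mid)
      have "\<bar>G l \<xi>\<bar> = (\<Sum>l'\<in>S - {l}. a l' * k l' \<xi>)" using True nn by (simp add: G_def sp)
      also have "\<dots> \<le> (\<Sum>l'\<in>S - {l}. a l' * \<delta>)"
      proof (intro sum_mono mult_left_mono ktail)
        fix l' assume l': "l' \<in> S - {l}"
        have "1 / N = 1 / (2 * N) + 1 / (2 * N)" using N by (simp add: field_simps)
        moreover have "1 / N \<le> \<bar>b l - b l'\<bar>" using l' by (intro bdist) auto
        ultimately show "1 / (2 * N) \<le> \<bar>\<xi> - b l'\<bar>" using \<xi> by linarith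
        show "0 \<le> a l'" using a l' by simp
      qed
      also have "\<dots> \<le> (\<Sum>l'\<in>S. a l' * \<delta>)"
        using S a \<delta>0 by (intro sum_mono2) auto
      finally show ?thesis by (simp add: s_def sum_distrib_right)
    next
      case False
      then have "1 / (2 * N) \<le> \<bar>\<xi> - b l\<bar>" by (auto simp: grid_interval_def mid)
      then have "a l * k l \<xi> \<le> a l * \<delta>" using a l by (intro mult_left_mono ktail) auto
      also have "\<dots> \<le> s * \<delta>"
        using member_le_sum[of l S a] S a l \<delta>0 by (intro mult_right_mono) (auto simp: s_def)
      finally show ?thesis using False nn by (simp add: G_def)
    qed
  qed
  have Kint: "integrable lborel (\<lambda>\<xi>. \<Sum>l'\<in>S. a l' * k l' \<xi>)" and K1: "(LINT \<xi>|lborel. (\<Sum>l'\<in>S. a l' * k l' \<xi>)) = s"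
    using kint k1 by (auto simp: s_def)
  have [measurable]: "grid_interval N l \<in> sets borel" for l by (simp add: grid_interval_def)
  have [measurable]: "G l \<in> borel_measurable borel" for l unfolding G_def by measurable
  have Gint: "integrable lborel (G l)" if "l \<in> S" for l
    by (rule Bochner_Integration.integrable_bound[OF Kint]) (use Gle2[OF that] in \<open>auto intro: order_trans[OF _ abs_ge_self]\<close>)
  have GL1: "(LINT \<xi>|lborel. norm (complex_of_real (G l \<xi>))) \<le> s" if "l \<in> S" for l
    unfolding K1[symmetric] using Gint[OF that] Gle2[OF that] by (intro integral_mono Kint) auto
  have rest: "freq_restrict (grid_interval N l) f x = of_real (a l) * (e (b l * x) * of_real (gauss \<epsilon> x)) + inv_fourier (\<lambda>\<xi>. of_real (G l \<xi>)) x"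
    if "l \<in> S" for l x
  proof -
    have "freq_restrict (grid_interval N l) f x =
       inv_fourier (\<lambda>\<xi>. of_real (a l) * of_real (k l \<xi>) + of_real (G l \<xi>)) x"
      unfolding freq_restrict_eq_inv_fourier ff G_def by (simp add: of_real_indicator)
    also have "\<dots> = of_real (a l) * inv_fourier (\<lambda>\<xi>. of_real (k l \<xi>)) x + inv_fourier (\<lambda>\<xi>. of_real (G l \<xi>)) x"
      unfolding inv_fourier_def distrib_right mult.assoc
      using Gint[OF that] kint[of l]
      by (subst Bochner_Integration.integral_add) (auto intro!: integrable_mult_e integrable_mult_right)
    finally show ?thesis by (simp only: invk)
  qed
  have gp: "(\<integral>\<^sup>+x. ennreal (gauss \<epsilon> x ^ ?p) \<partial>lborel) = ennreal w"
  proof -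
    have pos: "\<epsilon> * sqrt ?p > 0" using \<epsilon> n by simp
    have "(\<integral>\<^sup>+x. ennreal (gauss \<epsilon> x ^ ?p) \<partial>lborel) = ennreal (LINT x|lborel. gauss (\<epsilon> * sqrt ?p) x)"
      unfolding gauss_power
      by (rule nn_integral_eq_integral[OF gauss_integrable[OF less_imp_neq[OF pos, symmetric]]])
         (simp add: gauss_pos less_imp_le)
    also have "\<dots> = ennreal w" using gauss_integral[OF pos] n N M1 by (simp add: \<epsilon>_def w_def)
    finally show ?thesis .
  qed
  have p: "?p \<ge> 1" "?p \<ge> 2" "real ?p = 2 * real n" using n by auto
  \<comment> \<open>The norm of the Gaussian envelope, which factors out of the bound for every
    piece.\<close>
  define w' where "w' = w powr (1 / ?p)"
  have w': "w' ^ ?p = w" "w' \<ge> 0"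
    using w p by (simp_all add: w'_def powr_powr flip: powr_realpow)
  have Lf: "Lp_norm (2 * real n) lborel (freq_restrict (grid_interval N l) f) \<le> ennreal (2 * (a l + \<eta>) * w')"
    if l: "l \<in> S" for l
  proof (subst Lp_norm_even_le_iff[OF n])
    show "0 \<le> 2 * (a l + \<eta>) * w'" using a[OF l] \<eta> w' by simp
    have u: "(\<integral>\<^sup>+x. ennreal (norm (of_real (a l) * (e (b l * x) * of_real (gauss \<epsilon> x))) ^ ?p) \<partial>lborel)
       = ennreal (a l ^ ?p * w)"
    proof -
      have "(\<integral>\<^sup>+x. ennreal (norm (of_real (a l) * (e (b l * x) * of_real (gauss \<epsilon> x))) ^ ?p) \<partial>lborel)
        = (\<integral>\<^sup>+x. ennreal (a l ^ ?p) * ennreal (gauss \<epsilon> x ^ ?p) \<partial>lborel)"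
        using a[OF l] gauss_pos[of \<epsilon>, THEN less_imp_le]
        by (intro nn_integral_cong) (simp add: norm_mult power_mult_distrib ennreal_mult)
      also have "\<dots> = ennreal (a l ^ ?p) * ennreal w"
        by (subst nn_integral_cmult) (auto simp: gp)
      finally show ?thesis using a[OF l] w by (simp add: ennreal_mult)
    qed
    have v: "(\<integral>\<^sup>+x. ennreal (norm (inv_fourier (\<lambda>\<xi>. of_real (G l \<xi>)) x) ^ ?p) \<partial>lborel) \<le> ennreal (\<eta> ^ ?p * w)"
    proof -
      have "(\<integral>\<^sup>+x. ennreal (norm (inv_fourier (\<lambda>\<xi>. of_real (G l \<xi>)) x) ^ ?p) \<partial>lborel)
        \<le> ennreal (s ^ (?p - 1) * (s * \<delta>))"
        using Gint[OF l] Gle[OF l] GL1[OF l] p by (intro inv_fourier_Lp) auto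
      also have "s ^ (?p - 1) * (s * \<delta>) = s ^ ?p * \<delta>"
        using p by (simp add: power_eq_if)
      also have "ennreal \<dots> \<le> ennreal (\<eta> ^ ?p * w)" using s\<delta> by (rule ennreal_leI)
      finally show ?thesis .
    qed
    have "(\<integral>\<^sup>+x. ennreal (norm (freq_restrict (grid_interval N l) f x) ^ ?p) \<partial>lborel)
      \<le> ennreal (2 ^ ?p) * (ennreal (a l ^ ?p * w) + ennreal (\<eta> ^ ?p * w))"
      unfolding rest[OF l]
      by (rule order_trans[OF nn_integral_norm_add_power_le mult_left_mono[OF add_mono[OF eq_refl[OF u] v]]]) auto
    also have "\<dots> = ennreal (2 ^ ?p * ((a l ^ ?p + \<eta> ^ ?p) * w))"
      using a[OF l] \<eta> w by (simp add: ennreal_mult ennreal_plus distrib_right)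
    also have "\<dots> \<le> ennreal (2 ^ ?p * ((a l + \<eta>) ^ ?p * w))"
      using a[OF l] \<eta> w p by (intro ennreal_leI mult_left_mono mult_right_mono add_power_le) auto
    also have "2 ^ ?p * ((a l + \<eta>) ^ ?p * w) = (2 * (a l + \<eta>) * w') ^ ?p"
      by (simp only: power_mult_distrib w' mult.assoc)
    finally show "(\<integral>\<^sup>+x. ennreal (norm (freq_restrict (grid_interval N l) f x) ^ ?p) \<partial>lborel)
      \<le> ennreal ((2 * (a l + \<eta>) * w') ^ ?p)" .
  qed
  \<comment> \<open>The total frequency error, estimated as a single density at the price of a
    factor \<open>m\<close> in both height and mass.\<close>
  let ?R = "\<lambda>x. inv_fourier (\<lambda>\<xi>. of_real (\<Sum>l\<in>S. G l \<xi>)) x"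
  let ?T = "\<lambda>x. \<Sum>l\<in>S. complex_of_real (a l) * e (of_int l * x)"
  let ?F = "\<lambda>x. \<Sum>l\<in>S. freq_restrict (grid_interval N l) f x"
  let ?q = "sqrt (\<Sum>l\<in>S. (a l + \<eta>)\<^sup>2)"
  have q0: "?q \<ge> 0" by (simp add: sum_nonneg)
  have F: "(\<integral>\<^sup>+x. ennreal (norm (?F x) ^ ?p) \<partial>lborel) \<le> ennreal ((2 * \<kappa> * ?q) ^ ?p * w)"
  proof -
    have "Lp_norm (2 * real n) lborel ?F \<le> ennreal \<kappa> *
        ennreal_powr (\<Sum>l\<in>S. (Lp_norm (2 * real n) lborel (freq_restrict (grid_interval N l) f))\<^sup>2) (1 / 2)"
      by (rule adm[OF f])
    also have "\<dots> \<le> ennreal \<kappa> * ennreal_powr (\<Sum>l\<in>S. (ennreal (2 * (a l + \<eta>) * w'))\<^sup>2) (1 / 2)"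
      by (intro mult_left_mono ennreal_powr_mono sum_mono power_mono Lf) auto
    also have "\<dots> = ennreal \<kappa> * ennreal (sqrt (\<Sum>l\<in>S. (2 * (a l + \<eta>) * w')\<^sup>2))"
      using a \<eta> w' by (subst ennreal_powr_half_sum_squares) auto
    also have "(\<Sum>l\<in>S. (2 * (a l + \<eta>) * w')\<^sup>2) = (2 * w')\<^sup>2 * (\<Sum>l\<in>S. (a l + \<eta>)\<^sup>2)"
      unfolding sum_distrib_left by (intro sum.cong refl) (simp only: power_mult_distrib mult_ac)
    also have "ennreal \<kappa> * ennreal (sqrt \<dots>) = ennreal (2 * \<kappa> * ?q * w')"
      using w' \<kappa> q0 by (simp add: real_sqrt_mult ennreal_mult[symmetric] mult_ac)
    finally have "(\<integral>\<^sup>+x. ennreal (norm (?F x) ^ ?p) \<partial>lborel) \<le> ennreal ((2 * \<kappa> * ?q * w') ^ ?p)"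
      using w' \<kappa> q0 by (subst (asm) Lp_norm_even_le_iff[OF n]) auto
    then show ?thesis by (simp only: power_mult_distrib[of _ w'] w')
  qed
  have R: "(\<integral>\<^sup>+x. ennreal (norm (- ?R x) ^ ?p) \<partial>lborel) \<le> ennreal (\<eta> ^ ?p * w)"
  proof -
    have "(\<integral>\<^sup>+x. ennreal (norm (?R x) ^ ?p) \<partial>lborel) \<le> ennreal ((m * s) ^ (?p - 1) * (m * (s * \<delta>)))"
    proof (rule inv_fourier_Lp)
      show "integrable lborel (\<lambda>\<xi>. complex_of_real (\<Sum>l\<in>S. G l \<xi>))" using Gint by simp
      show "norm (complex_of_real (\<Sum>l\<in>S. G l \<xi>)) \<le> m * (s * \<delta>)" for \<xi>
        using sum_bounded_above[of S "\<lambda>l. \<bar>G l \<xi>\<bar>" "s * \<delta>"] Gle sum_abs[of "\<lambda>l. G l \<xi>" S]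
        unfolding m_def norm_of_real by (meson order_trans)
      have "(LINT \<xi>|lborel. norm (complex_of_real (\<Sum>l\<in>S. G l \<xi>))) \<le> (LINT \<xi>|lborel. (\<Sum>l\<in>S. norm (complex_of_real (G l \<xi>))))"
        using Gint by (intro integral_mono) (auto simp del: of_real_sum)
      also have "\<dots> = (\<Sum>l\<in>S. (LINT \<xi>|lborel. norm (complex_of_real (G l \<xi>))))"
        using Gint by (intro Bochner_Integration.integral_sum) auto
      also have "\<dots> \<le> m * s"
        unfolding m_def using GL1 by (intro sum_bounded_above) auto
      finally show "(LINT \<xi>|lborel. norm (complex_of_real (\<Sum>l\<in>S. G l \<xi>))) \<le> m * s" .
    qed (use p in auto)
    also have "(m * s) ^ (?p - 1) * (m * (s * \<delta>)) = (m * s) ^ ?p * \<delta>"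
      using p by (simp add: power_eq_if)
    also have "ennreal \<dots> \<le> ennreal (\<eta> ^ ?p * w)" using \<delta> by (rule ennreal_leI)
    finally show ?thesis by simp
  qed
  have FR: "norm (?F x + - ?R x) = norm (?T (x / N)) * gauss \<epsilon> x" for x
  proof -
    have "?R x = (\<Sum>l\<in>S. inv_fourier (\<lambda>\<xi>. of_real (G l \<xi>)) x)"
      unfolding inv_fourier_def of_real_sum sum_distrib_right
      using Gint by (intro Bochner_Integration.integral_sum integrable_mult_e) auto
    then have "?F x + - ?R x = (\<Sum>l\<in>S. of_real (a l) * (e (b l * x) * of_real (gauss \<epsilon> x)))"
      by (simp add: rest sum.distrib)
    \<comment> \<open>The half-cell shift is common to all midpoints and unimodular, so it
      disappears in the norm; what is left is periodic in x/N.\<close>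
    also have "\<dots> = (e (x / (2 * N)) * of_real (gauss \<epsilon> x)) * ?T (x / N)"
    proof -
      have "e (b l * x) = e (x / (2 * N)) * e (of_int l * (x / N))" for l
        using N by (simp add: e_add[symmetric] b_def field_simps)
      then show ?thesis unfolding sum_distrib_left by (intro sum.cong refl) (simp add: mult_ac)
    qed
    finally show ?thesis using gauss_pos[of \<epsilon> x] by (simp add: norm_mult)
  qed
  have low: "ennreal (exp (- pi) * w * energy S n a) \<le> (\<integral>\<^sup>+x. ennreal (norm (?F x + - ?R x) ^ ?p) \<partial>lborel)"
  proof -
    let ?g = "\<lambda>y. ennreal (norm (?T y) ^ ?p)"
    have gm [measurable]: "?g \<in> borel_measurable borel" by measurable
    have "?T (y + 1) = ?T y" for y
      by (simp add: distrib_left e_add)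
    then have per: "?g (y + 1) = ?g y" for y by simp
    \<comment> \<open>The form \<open>0 + N * y\<close> anticipates the substitution x = N
      y.\<close>
    have lo: "ennreal (exp (- pi)) * (?g y * indicator {0..<real M} y) \<le> ennreal (norm (?T ((0 + N * y) / N)) ^ ?p * gauss \<epsilon> (0 + N * y) ^ ?p)" for y
    proof (cases "y \<in> {0..<real M}")
      case True
      have "(\<epsilon> * sqrt ?p * (N * y))\<^sup>2 = (y / real M)\<^sup>2"
        using n N by (simp add: \<epsilon>_def)
      also have "\<dots> \<le> 1"
        using True M1 by (simp add: power_le_one)
      finally have "exp (- pi) \<le> gauss \<epsilon> (N * y) ^ ?p"
        by (simp only: gauss_power) (simp add: gauss_def)
      then have "exp (- pi) * norm (?T y) ^ ?p \<le> gauss \<epsilon> (N * y) ^ ?p * norm (?T y) ^ ?p"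
        by (intro mult_right_mono) auto
      with True show ?thesis
        using N by (simp add: ennreal_mult[symmetric] mult.commute ennreal_leI)
    qed simp
    have "ennreal (exp (- pi) * w * energy S n a) = ennreal N * (ennreal (exp (- pi)) * (of_nat M * ennreal (energy S n a)))"
      unfolding w_def using N by (simp add: ennreal_mult' ennreal_of_nat_eq_real_of_nat mult_ac flip: ennreal_mult')
    also have "of_nat M * ennreal (energy S n a) = (\<integral>\<^sup>+x\<in>{0..<real M}. ?g x \<partial>lborel)"
      by (simp only: nn_integral_periodic[OF gm per] trig_moment[OF S(1)])
    also have "ennreal (exp (- pi)) * \<dots> = (\<integral>\<^sup>+y. ennreal (exp (- pi)) * (?g y * indicator {0..<real M} y) \<partial>lborel)"
      by (rule nn_integral_cmult[symmetric]) simp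
    also have "ennreal N * \<dots> \<le> ennreal N * (\<integral>\<^sup>+y. ennreal (norm (?T ((0 + N * y) / N)) ^ ?p * gauss \<epsilon> (0 + N * y) ^ ?p) \<partial>lborel)"
      by (intro mult_left_mono nn_integral_mono lo) auto
    also have "\<dots> = (\<integral>\<^sup>+x. ennreal (norm (?T (x / N)) ^ ?p * gauss \<epsilon> x ^ ?p) \<partial>lborel)"
      using N nn_integral_real_affine[of "\<lambda>x. ennreal (norm (?T (x / N)) ^ ?p * gauss \<epsilon> x ^ ?p)" N 0] by simp
    finally show ?thesis by (simp only: FR power_mult_distrib)
  qed
  have Fm: "?F \<in> borel_measurable borel"
    unfolding grid_interval_def
    by (intro borel_measurable_sum band_measurable[OF band_freq_restrict] schwartz_measurable f)
  have Rm: "(\<lambda>x. - ?R x) \<in> borel_measurable borel" by measurable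
  note low
  also have "(\<integral>\<^sup>+x. ennreal (norm (?F x + - ?R x) ^ ?p) \<partial>lborel) \<le>
     ennreal (2 ^ ?p) * (ennreal ((2 * \<kappa> * ?q) ^ ?p * w) + ennreal (\<eta> ^ ?p * w))"
    by (rule order_trans[OF nn_integral_norm_add_power_le[OF Fm Rm] mult_left_mono[OF add_mono[OF F R]]]) simp
  also have "\<dots> = ennreal (2 ^ ?p * ((2 * \<kappa> * ?q) ^ ?p + \<eta> ^ ?p) * w)"
    using \<kappa> q0 \<eta> w by (simp add: ennreal_mult ennreal_plus distrib_right mult.assoc)
  finally have "exp (- pi) * w * energy S n a \<le> 2 ^ ?p * ((2 * \<kappa> * ?q) ^ ?p + \<eta> ^ ?p) * w"
    using \<kappa> q0 \<eta> w by (subst (asm) ennreal_le_iff) auto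
  \<comment> \<open>Both sides carry the mass \<open>w\<close>; once it is cancelled, neither M nor
    the width remains.\<close>
  then have "w * (exp (- pi) * energy S n a) \<le> w * (2 ^ ?p * ((2 * \<kappa> * ?q) ^ ?p + \<eta> ^ ?p))"
    by (simp only: mult_ac)
  then show ?thesis using w by (simp only: mult_le_cancel_left_pos)
qed

text \<open>Origin of the constant: a factor 2 from separating main part and error in each piece,
  another 2 from doing so in the sum, and \<open>exp pi\<close> from the lower bound for the
  Gaussian over M periods.\<close>

theorem A_const_le_K_const:
  assumes S: "finite S" "S \<noteq> {}" and n: "n \<ge> 1" and N: "N > 0"
  shows "A_const (2 * real n) S \<le> ennreal (4 * exp pi) * K_const (2 * real n) (grid_interval N ` S)"
  unfolding K_const_def
proof (rule le_mult_Inf_ennreal)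
  fix C assume "C \<in> {C. \<forall>f. schwartz f \<longrightarrow>
     Lp_norm (2 * real n) lborel (\<lambda>x. \<Sum>I\<in>grid_interval N ` S. freq_restrict I f x)
       \<le> C * ennreal_powr (\<Sum>I\<in>grid_interval N ` S. (Lp_norm (2 * real n) lborel (freq_restrict I f))\<^sup>2) (1 / 2)}"
  then have adm: "\<And>f. schwartz f \<Longrightarrow> Lp_norm (2 * real n) lborel (\<lambda>x. \<Sum>l\<in>S. freq_restrict (grid_interval N l) f x)
       \<le> C * ennreal_powr (\<Sum>l\<in>S. (Lp_norm (2 * real n) lborel (freq_restrict (grid_interval N l) f))\<^sup>2) (1 / 2)"
    by (simp add: sum.reindex[OF inj_grid_interval[OF N]])
  show "A_const (2 * real n) S \<le> ennreal (4 * exp pi) * C"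
  proof (cases C)
    case (real \<kappa>)
    have "ennreal (4 * exp pi * \<kappa>) \<in> A_admissible (2 * real n) S"
      unfolding A_admissible_def
    proof (intro CollectI allI impI)
      fix a :: "int \<Rightarrow> real" assume a: "\<forall>l\<in>S. 0 \<le> a l"
      let ?s = "sqrt (\<Sum>l\<in>S. (a l)\<^sup>2)"
      have s0: "?s \<ge> 0" by (simp add: sum_nonneg)
      let ?g = "\<lambda>\<eta>. 2 ^ (2 * n) * ((2 * \<kappa> * sqrt (\<Sum>l\<in>S. (a l + \<eta>)\<^sup>2)) ^ (2 * n) + \<eta> ^ (2 * n))"
      have g: "exp (- pi) * energy S n a \<le> ?g \<eta>" if "\<eta> > 0" for \<eta>
        using energy_le_gaussian_test[OF S n N real(1), of a \<eta>] a adm that real(2) by auto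
      have "(\<lambda>m. ?g (1 / real (Suc m))) \<longlonglongrightarrow> ?g 0"
      proof -
        have "(\<lambda>m. 1 / real (Suc m)) \<longlonglongrightarrow> 0"
          using LIMSEQ_inverse_real_of_nat by (simp add: inverse_eq_divide)
        then show ?thesis by (intro tendsto_intros)
      qed
      then have "exp (- pi) * energy S n a \<le> ?g 0"
        by (rule LIMSEQ_le_const) (auto intro!: g)
      also have "\<dots> = (4 * \<kappa> * ?s) ^ (2 * n)"
      proof -
        have "4 * \<kappa> * ?s = 2 * (2 * \<kappa> * ?s)" "(0::real) ^ (2 * n) = 0" using n by auto
        then show ?thesis by (simp only: power_mult_distrib add_0_right)
      qed
      finally have "energy S n a \<le> exp pi * (4 * \<kappa> * ?s) ^ (2 * n)"
        by (simp add: exp_minus field_simps)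
      \<comment> \<open>Deliberately crude, valid since exp(pi) \<ge> 1: under the 2n-th power the
        constant has a root that does not depend on n.\<close>
      also have "\<dots> \<le> exp pi ^ (2 * n) * (4 * \<kappa> * ?s) ^ (2 * n)"
        using n real(1) s0 self_le_power[of "exp pi" "2 * n"] by (intro mult_right_mono) auto
      also have "\<dots> = (4 * exp pi * \<kappa> * ?s) ^ (2 * n)"
        by (simp add: power_mult_distrib[symmetric] mult_ac)
      finally have "ennreal (energy S n a) \<le> ennreal ((4 * exp pi * \<kappa> * ?s) ^ (2 * n))"
        by (rule ennreal_leI)
      then have "Lp_norm (2 * real n) (restrict_space lborel {0..1})
         (\<lambda>x. \<Sum>l\<in>S. of_real (a l) * e (real_of_int l * x)) \<le> ennreal (4 * exp pi * \<kappa> * ?s)"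
        using real(1) s0 by (subst Lp_norm_even_le_iff[OF n]) (auto simp: trig_moment[OF S(1)])
      then show "Lp_norm (2 * real n) (restrict_space lborel {0..1})
         (\<lambda>x. \<Sum>l\<in>S. of_real (a l) * e (real_of_int l * x))
         \<le> ennreal (4 * exp pi * \<kappa>) * ennreal (sqrt (\<Sum>l\<in>S. (\<bar>a l\<bar>)\<^sup>2))"
        using real(1) s0 by (simp only: power2_abs ennreal_mult mult_nonneg_nonneg zero_le_numeral exp_ge_zero)
    qed
    then show ?thesis unfolding A_const_eq using real by (intro Inf_lower2) (auto simp: ennreal_mult)
  qed (simp add: ennreal_mult_top)
qed simp

section \<open>Ellipsephic sets\<close>

lemma ellipsephic_level_finite:
  assumes "finite D" shows "finite (ellipsephic_level D q j)"
proof -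
  have "ellipsephic_level D q j \<subseteq> (\<lambda>a. \<Sum>s<j. a s * q ^ s) ` ({..<j} \<rightarrow>\<^sub>E D)"
  proof
    fix x assume "x \<in> ellipsephic_level D q j"
    then obtain a where "x = (\<Sum>s<j. a s * q ^ s)" "\<forall>s<j. a s \<in> D"
      by (auto simp: ellipsephic_level_def)
    then show "x \<in> (\<lambda>a. \<Sum>s<j. a s * q ^ s) ` ({..<j} \<rightarrow>\<^sub>E D)"
      by (intro image_eqI[of _ _ "restrict a {..<j}"]) auto
  qed
  then show ?thesis
    by (rule finite_subset) (intro finite_imageI finite_PiE; simp add: assms)
qed

lemma ellipsephic_level_nonempty:
  assumes "D \<noteq> {}" shows "ellipsephic_level D q j \<noteq> {}"
proof -
  obtain x where "x \<in> D" using assms by auto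
  then have "(\<Sum>s<j. (\<lambda>_. x) s * q ^ s) \<in> ellipsephic_level D q j"
    unfolding ellipsephic_level_def by (intro CollectI exI[of _ "\<lambda>_. x"]) simp
  then show ?thesis by auto
qed

lemma cantor_intervals_eq:
  "cantor_intervals D q j = grid_interval (real_of_int q ^ j) ` ellipsephic_level D q j"
  by (simp add: cantor_intervals_def grid_interval_def Setcompr_eq_image)

lemma K_const_bounds:
  assumes D: "finite D" "D \<noteq> {}" and q: "q > 0" and n: "n \<ge> 1"
  shows "ennreal (1 / (4 * exp pi)) * A_const (2 * real n) (ellipsephic_level D q j)
           \<le> K_const (2 * real n) (cantor_intervals D q j)" (is "_ * ?A \<le> ?K")
    and "K_const (2 * real n) (cantor_intervals D q j)
           \<le> ennreal 2 * A_const (2 * real n) (ellipsephic_level D q j)"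
proof -
  note S = ellipsephic_level_finite[OF D(1), of q j] ellipsephic_level_nonempty[OF D(2), of q j]
  have N: "real_of_int q ^ j > 0" using q by simp
  show "?K \<le> ennreal 2 * ?A"
    unfolding cantor_intervals_eq by (rule K_const_le_A_const[OF S n N])
  have "ennreal (1 / (4 * exp pi)) * ?A \<le> ennreal (1 / (4 * exp pi)) * (ennreal (4 * exp pi) * ?K)"
    unfolding cantor_intervals_eq by (intro mult_left_mono A_const_le_K_const[OF S n N]) auto
  also have "\<dots> = ?K"
  proof -
    have "ennreal (1 / (4 * exp pi)) * ennreal (4 * exp pi) = 1"
      by (subst ennreal_mult[symmetric]) auto
    then show ?thesis by (simp only: mult.assoc[symmetric] mult_1)
  qed
  finally show "ennreal (1 / (4 * exp pi)) * ?A \<le> ?K" .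
qed

text \<open>By the two-sided bounds the logarithms differ by at most \<open>c\<close> for every j,
  while the denominator grows linearly because \<open>card D\<close> \<ge> 2. One quotient is
  therefore the other plus a null sequence.\<close>

lemma kappa_eq_alpha:
  assumes D: "finite D" "card D \<ge> 2" and q: "q > 0" and n: "n \<ge> 1"
  shows "kappa_exponent (2 * real n) D q = alpha_exponent (2 * real n) D q"
proof -
  have D0: "D \<noteq> {}" using D by auto
  let ?A = "\<lambda>j. A_const (2 * real n) (ellipsephic_level D q j)"
  let ?K = "\<lambda>j. K_const (2 * real n) (cantor_intervals D q j)"
  define a where "a j = enn2real (?A j)" for j
  define k where "k j = enn2real (?K j)" for j
  let ?L = "\<lambda>j. ln (real (card D) ^ j)"
  define c where "c = max (ln 2) (ln (4 * exp pi))"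
  have A: "?A j = ennreal (a j)" "1 \<le> a j" for j
  proof -
    have "?A j < \<infinity>" "1 \<le> ?A j"
      by (intro A_const_finite A_const_ge_1 ellipsephic_level_finite ellipsephic_level_nonempty D D0 n)+
    then show "?A j = ennreal (a j)" "1 \<le> a j"
      unfolding a_def by (cases "?A j"; simp)+
  qed
  have K: "?K j = ennreal (k j)" "a j / (4 * exp pi) \<le> k j" "k j \<le> 2 * a j" for j
  proof -
    note b = K_const_bounds[OF D(1) D0 q n, of j, unfolded A(1)]
    have le: "?K j \<le> ennreal (2 * a j)" using b(2) A(2)[of j] by (simp add: ennreal_mult)
    then show eq: "?K j = ennreal (k j)"
      unfolding k_def by (cases "?K j") (auto simp: top_unique)
    have k0: "k j \<ge> 0" by (simp add: k_def)
    show "k j \<le> 2 * a j" using le A(2)[of j] unfolding eq by (subst (asm) ennreal_le_iff) auto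
    have "ennreal (1 / (4 * exp pi) * a j) \<le> ennreal (k j)"
      using b(1) A(2)[of j] unfolding eq by (subst ennreal_mult) auto
    then show "a j / (4 * exp pi) \<le> k j" using k0 by (subst (asm) ennreal_le_iff) auto
  qed
  have k0: "k j > 0" for j
  proof -
    have "0 < a j / (4 * exp pi)" using A(2)[of j] by simp
    then show ?thesis using K(2)[of j] by linarith
  qed
  have lnA: "ennreal_ln (?A j) = ereal (ln (a j))" for j
    unfolding A(1) using A(2)[of j] by (simp add: ennreal_ln_def ennreal_eq_0_iff)
  have lnK: "ennreal_ln (?K j) = ereal (ln (k j))" for j
    unfolding K(1) using k0[of j] by (simp add: ennreal_ln_def ennreal_eq_0_iff)
  have diff: "\<bar>ln (k j) - ln (a j)\<bar> \<le> c" for j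
  proof -
    have a0: "a j > 0" using A(2)[of j] by linarith
    have "ln (k j) \<le> ln (2 * a j)" using K(3) k0 a0 by simp
    moreover have "ln (a j / (4 * exp pi)) \<le> ln (k j)" using K(2) k0 a0 by (subst ln_le_cancel_iff) auto
    ultimately show ?thesis using a0 by (simp add: c_def ln_mult ln_div)
  qed
  have L: "?L j = real j * ln (real (card D))" for j
    using D by (simp add: ln_realpow)
  have lnD: "ln (real (card D)) > 0" using D by simp
  have "(\<lambda>j. (ln (k j) - ln (a j)) / ?L j) \<longlonglongrightarrow> 0"
  proof (rule Lim_null_comparison)
    show "\<forall>\<^sub>F j in sequentially. norm ((ln (k j) - ln (a j)) / ?L j) \<le> c / ln (real (card D)) * (1 / real j)"
    \<comment> \<open>The index j = 0 is included: both sides are then 0 by division by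
      zero.\<close>
    proof (intro always_eventually allI)
      fix j
      have "norm ((ln (k j) - ln (a j)) / ?L j) = \<bar>ln (k j) - ln (a j)\<bar> / (real j * ln (real (card D)))"
        unfolding L using lnD by (simp add: abs_mult)
      also have "\<dots> \<le> c / (real j * ln (real (card D)))"
        using diff lnD by (intro divide_right_mono) auto
      finally show "norm ((ln (k j) - ln (a j)) / ?L j) \<le> c / ln (real (card D)) * (1 / real j)"
        by (simp add: mult.commute)
    qed
    have "(\<lambda>j. c / ln (real (card D)) * (1 / real j)) \<longlonglongrightarrow> c / ln (real (card D)) * 0"
      by (intro tendsto_intros lim_1_over_n)
    then show "(\<lambda>j. c / ln (real (card D)) * (1 / real j)) \<longlonglongrightarrow> 0" by simp
  qed
  then have "(\<lambda>j. ereal ((ln (k j) - ln (a j)) / ?L j)) \<longlonglongrightarrow> 0"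
    by (simp add: zero_ereal_def)
  \<comment> \<open>A limsup is additive when one summand has a finite limit; the other sequence may
    fail to converge.\<close>
  then have "limsup (\<lambda>j. ereal ((ln (k j) - ln (a j)) / ?L j) + ennreal_ln (?A j) / ereal (?L j))
      = 0 + alpha_exponent (2 * real n) D q"
    using ereal_limsup_lim_add[of "\<lambda>j. ereal ((ln (k j) - ln (a j)) / ?L j)" 0 "\<lambda>j. ennreal_ln (?A j) / ereal (?L j)"]
    by (simp only: alpha_exponent_def) simp
  moreover have "limsup (\<lambda>j. ereal ((ln (k j) - ln (a j)) / ?L j) + ennreal_ln (?A j) / ereal (?L j))
     = kappa_exponent (2 * real n) D q"
    unfolding kappa_exponent_def
  proof (rule Limsup_eq)
    show "\<forall>\<^sub>F j in sequentially. ereal ((ln (k j) - ln (a j)) / ?L j) + ennreal_ln (?A j) / ereal (?L j)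
       = ennreal_ln (?K j) / ereal (?L j)"
      \<comment> \<open>At j = 0 the denominator ln 1 vanishes, and division by 0 in
        \<open>ereal\<close> differs from that in the reals; the limsup ignores this index.\<close>
      using eventually_gt_at_top[of 0]
    proof eventually_elim
      case (elim j)
      then have "?L j \<noteq> 0" unfolding L using lnD by simp
      then show ?case unfolding lnA lnK by (simp add: diff_divide_distrib)
    qed
  qed
  ultimately show ?thesis by simp
qed

theorem proposition3p4:
  shows "(\<exists>c1 c2 :: real. c1 > 0 \<and> c2 > 0 \<and>
      (\<forall>(n :: nat) (j :: nat) (k :: nat) (q :: int) (d :: nat \<Rightarrow> int).
         n \<ge> 1 \<longrightarrow> j \<ge> 1 \<longrightarrow> k \<ge> 1 \<longrightarrow>
         0 \<le> d 1 \<longrightarrow> strict_mono_on {1..k} d \<longrightarrow> d k < q \<longrightarrow>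
           ennreal c1 * A_const (2 * real n) (ellipsephic_level (d ` {1..k}) q j)
             \<le> K_const (2 * real n) (cantor_intervals (d ` {1..k}) q j) \<and>
           K_const (2 * real n) (cantor_intervals (d ` {1..k}) q j)
             \<le> ennreal c2 * A_const (2 * real n) (ellipsephic_level (d ` {1..k}) q j)))
    \<and> (\<forall>(n :: nat) (k :: nat) (q :: int) (d :: nat \<Rightarrow> int).
         n \<ge> 1 \<longrightarrow> k \<ge> 2 \<longrightarrow>
         0 \<le> d 1 \<longrightarrow> strict_mono_on {1..k} d \<longrightarrow> d k < q \<longrightarrow>
           kappa_exponent (2 * real n) (d ` {1..k}) q
             = alpha_exponent (2 * real n) (d ` {1..k}) q)"
proof -
  \<comment> \<open>From 0 \<le> d_1 \<le> d_k < q; it makes the grid scale N = q^j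
    positive.\<close>
  have q: "q > 0" if "k \<ge> 1" "0 \<le> d 1" "strict_mono_on {1..k} d" "d k < q" for k q and d :: "nat \<Rightarrow> int"
  proof -
    have "d 1 \<le> d k"
      using strict_mono_on_leD[OF that(3), of 1 k] that(1) by simp
    with that show ?thesis by linarith
  qed
  \<comment> \<open>Strict monotonicity makes the digits distinct, so the cardinality in the
    exponents is k.\<close>
  have card: "card (d ` {1..k}) = k" if "strict_mono_on {1..k} d" for k and d :: "nat \<Rightarrow> int"
    using card_image[OF strict_mono_on_imp_inj_on[OF that]] by simp
  show ?thesis
  proof ((rule conjI, rule exI[of _ "1 / (4 * exp pi)"], rule exI[of _ 2]); intro conjI allI impI)
    fix n k :: nat and q :: int and d :: "nat \<Rightarrow> int"
    assume *: "n \<ge> 1" "k \<ge> 2" "0 \<le> d 1" "strict_mono_on {1..k} d" "d k < q"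
    show "kappa_exponent (2 * real n) (d ` {1..k}) q = alpha_exponent (2 * real n) (d ` {1..k}) q"
    proof (rule kappa_eq_alpha)
      show "q > 0" using *(2) by (intro q[OF _ *(3-5)]) simp
    qed (use *(1,2) card[OF *(4)] in simp_all)
  next
    fix n j k :: nat and q :: int and d :: "nat \<Rightarrow> int"
    assume *: "n \<ge> 1" "k \<ge> 1" "0 \<le> d 1" "strict_mono_on {1..k} d" "d k < q"
    have D: "finite (d ` {1..k})" "d ` {1..k} \<noteq> {}" "q > 0"
      using q[OF *(2-5)] *(2) by simp_all
    show "ennreal (1 / (4 * exp pi)) * A_const (2 * real n) (ellipsephic_level (d ` {1..k}) q j)
           \<le> K_const (2 * real n) (cantor_intervals (d ` {1..k}) q j)"
      and "K_const (2 * real n) (cantor_intervals (d ` {1..k}) q j)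
           \<le> ennreal 2 * A_const (2 * real n) (ellipsephic_level (d ` {1..k}) q j)"
      by (fact K_const_bounds[OF D *(1)])+
  qed simp_all
qed

end
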